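(* Let $(M,g,S(TM))$ be a null hypersurface of a Lorentzian manifold $(\bar M,\bar g)$ whose screen distribution $S(TM)$ is integrable, and let $Z\in\Gamma(T\bar M)$ be a closed conformal vector field, with $\bar\nabla_XZ=\varphi X$ for all $X\in\Gamma(T\bar M)$, which is nowhere null along $M$. If $(M,g,S(TM))$ has constant angle with respect to $Z$, then $Z$ is a canonical principal direction with respect to $A_{Z^\perp}$. Moreover, $$A_{Z^\perp}\overset{*}{Z}=-2\,\varepsilon_Z\,\measuredangle(Z,\xi)\,\measuredangle(Z,N)\,\varphi\,\overset{*}{Z},$$ where $\varepsilon_Z=\pm1$ is the sign of $\bar g(Z,Z)$ and $\{\xi,N\}$ is a null frame.
   Context: Null hypersurfaces. $(\bar M,\bar g)$ is an $(n+2)$-dimensional Lorentzian manifold with Levi-Civita connection $\bar\nabla$. A null hypersurface $(M,g,S(TM))$ consists of an immersed $(n+1)$-manifold $M$ with degenerate induced metric $g$ (so $\mathrm{rad}(TM)=TM\cap TM^\perp$ is a line bundle) and a screen distribution, i.e. a subbundle $S(TM)\subset TM$ with $TM=S(TM)\oplus\mathrm{rad}(TM)$; $\bar g$ is positive definite on $S(TM)$ and $P:TM\to S(TM)$ is the projection. A null frame $\{\xi,N\}$ consists of a nowhere zero section $\xi$ of $\mathrm{rad}(TM)$ and the unique vector field $N$ along $M$ with $\bar g(\xi,N)=1$, $\bar g(N,N)=0$, $\bar g(N,X)=0$ for all $X\in\Gamma(S(TM))$. Then $T\bar M|_M=S(TM)\oplus\mathrm{span}(\xi)\oplus\mathrm{span}(N)$,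 with $\mathrm{tr}(TM)=\mathrm{span}(N)$. For $X,Y\in\Gamma(TM)$, the induced connection $\nabla$, the screen connection $\nabla^*$ (also written $\overset{*}{\nabla}$), the bilinear forms $B,C$, the shape operators $A_N,A^*_\xi$ (both $S(TM)$-valued) and the one-form $\tau$ are defined by $\bar\nabla_XY=\nabla_XY+B(X,Y)N$, $\ \bar\nabla_XN=-A_NX+\tau(X)N$, $\ \nabla_XPY=\nabla^*_XPY+C(X,PY)\xi$, $\ \nabla_X\xi=-A^*_\xi X-\tau(X)\xi$. Along $M$ one decomposes $Z=\overset{*}{Z}+\bar g(Z,N)\xi+\bar g(Z,\xi)N$ with $\overset{*}{Z}\in\Gamma(S(TM))$, and $Z^\perp=\bar g(Z,N)\xi+\bar g(Z,\xi)N$. The operator $A_{Z^\perp}$ on $S(TM)$ is $A_{Z^\perp}X=\bar g(Z,N)A^*_\xi X+\bar g(Z,\xi)A_NX$ (independent of the null frame). For a nowhere null vector field $V$ along $M$, $|V|=\sqrt{|\bar g(V,V)|}$, $\measuredangle(V,\xi)=\bar g(V,\xi)/|V|$, $\measuredangle(V,N)=\bar g(V,N)/|V|$. $(M,g,S(TM))$ has constant angle with respect to $V$ if there is a null frame $\{\xi,N\}$ for which both functions $\measuredangle(V,\xi)$ and $\measuredangle(V,N)$ are constant on $M$. (The product $\measuredangle(V,\xi)\measuredangle(V,N)$ does not depend on the null frame.) $Z$ is a canonical principal direction with respect to $A_{Z^\perp}$ if $A_{Z^\perp}\overset{*}{Z}=\lambda\overset{*}{Z}$ for some smooth function $\lambda$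 on $M$. *)

theory Defs
  imports "HOL-Analysis.Analysis"
begin

section \<open>Smooth manifolds\<close>

text \<open>
  \<open>Ck_on k U h\<close> is only used for open \<open>U\<close> in a Euclidean space, where it says that all partial
  derivatives of \<open>h\<close> of order at most \<open>k\<close> exist and are continuous on \<open>U\<close>.
\<close>

primrec Ck_on :: "nat \<Rightarrow> 'a::real_normed_vector set \<Rightarrow> ('a \<Rightarrow> 'b::real_normed_vector) \<Rightarrow> bool" where
  "Ck_on 0 U h \<longleftrightarrow> continuous_on U h"
| "Ck_on (Suc k) U h \<longleftrightarrow>
     (\<forall>x\<in>U. h differentiable (at x)) \<and> (\<forall>v. Ck_on k U (\<lambda>x. frechet_derivative h (at x) v))"

definition smooth_on :: "'a::real_normed_vector set \<Rightarrow> ('a \<Rightarrow> 'b::real_normed_vector) \<Rightarrow> bool" where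
  "smooth_on U h \<longleftrightarrow> (\<forall>k. Ck_on k U h)"

text \<open>
  A manifold is a Hausdorff second countable type \<open>'p\<close> with a smooth atlas \<open>A\<close> modelled on a
  Euclidean space \<open>'e\<close>; its dimension is \<open>DIM('e)\<close>. A chart is a pair (domain, coordinate map);
  the values of the coordinate map outside its domain are irrelevant.
\<close>

type_synonym ('p, 'e) chart = "'p set \<times> ('p \<Rightarrow> 'e)"

definition chart_inv :: "('p, 'e) chart \<Rightarrow> 'e \<Rightarrow> 'p" where
  "chart_inv c = inv_into (fst c) (snd c)"

definition is_chart :: "('p::topological_space, 'e::euclidean_space) chart \<Rightarrow> bool" where
  "is_chart c \<longleftrightarrow> open (fst c) \<and> open (snd c ` fst c) \<and>
     homeomorphism (fst c) (snd c ` fst c) (snd c) (chart_inv c)"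

definition smooth_atlas :: "('p::topological_space, 'e::euclidean_space) chart set \<Rightarrow> bool" where
  "smooth_atlas A \<longleftrightarrow> (\<forall>c\<in>A. is_chart c) \<and> (\<Union>c\<in>A. fst c) = UNIV \<and>
     (\<forall>c\<in>A. \<forall>d\<in>A. smooth_on (snd c ` (fst c \<inter> fst d)) (snd d \<circ> chart_inv c))"

text \<open>
  For every point \<open>p\<close> a preferred chart around \<open>p\<close> is chosen, and the tangent space at \<open>p\<close> is
  identified with the model space \<open>'e\<close> by means of that chart. A tangent vector at \<open>p\<close> is thus
  an element of \<open>'e\<close>, and a vector field is a function \<open>'p \<Rightarrow> 'e\<close>. Since the preferred chart
  changes from point to point (not even continuously), smoothness of a vector field is always
  expressed through its components \<open>to_coord A c\<close> in charts \<open>c\<close> of the atlas.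
\<close>

definition chart_at :: "('p, 'e) chart set \<Rightarrow> 'p \<Rightarrow> ('p, 'e) chart" where
  "chart_at A p = (SOME c. c \<in> A \<and> p \<in> fst c)"

text \<open>The derivative \<open>v(h)\<close> of a function \<open>h\<close> in the direction of the tangent vector \<open>v\<close> at \<open>p\<close>.\<close>

definition dir_deriv ::
  "('p, 'e::euclidean_space) chart set \<Rightarrow> 'p \<Rightarrow> 'e \<Rightarrow> ('p \<Rightarrow> 'c::real_normed_vector) \<Rightarrow> 'c" where
  "dir_deriv A p v h =
     frechet_derivative (h \<circ> chart_inv (chart_at A p)) (at (snd (chart_at A p) p)) v"

text \<open>
  \<open>to_coord A c p v\<close>: the components in the chart \<open>c\<close> of the tangent vector \<open>v\<close> at \<open>p\<close>;
  \<open>of_coord A c p u\<close>: the tangent vector at \<open>p\<close> with components \<open>u\<close> in the chart \<open>c\<close>.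
  In particular \<open>\<lambda>p. of_coord A c p i\<close> with \<open>i \<in> Basis\<close> are the coordinate vector fields of \<open>c\<close>.
\<close>

definition to_coord ::
  "('p, 'e::euclidean_space) chart set \<Rightarrow> ('p, 'e) chart \<Rightarrow> 'p \<Rightarrow> 'e \<Rightarrow> 'e" where
  "to_coord A c p v = dir_deriv A p v (snd c)"

definition of_coord ::
  "('p, 'e::euclidean_space) chart set \<Rightarrow> ('p, 'e) chart \<Rightarrow> 'p \<Rightarrow> 'e \<Rightarrow> 'e" where
  "of_coord A c p u = frechet_derivative (snd (chart_at A p) \<circ> chart_inv c) (at (snd c p)) u"

text \<open>In the following two definitions \<open>U\<close> is meant to be open.\<close>

definition smooth_fun_on ::
  "('p, 'e::euclidean_space) chart set \<Rightarrow> 'p set \<Rightarrow> ('p \<Rightarrow> 'c::real_normed_vector) \<Rightarrow> bool" where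
  "smooth_fun_on A U h \<longleftrightarrow> (\<forall>c\<in>A. smooth_on (snd c ` (fst c \<inter> U)) (h \<circ> chart_inv c))"

definition smooth_vf_on ::
  "('p, 'e::euclidean_space) chart set \<Rightarrow> 'p set \<Rightarrow> ('p \<Rightarrow> 'e) \<Rightarrow> bool" where
  "smooth_vf_on A U X \<longleftrightarrow>
     (\<forall>c\<in>A. smooth_on (snd c ` (fst c \<inter> U)) ((\<lambda>p. to_coord A c p (X p)) \<circ> chart_inv c))"

text \<open>The formula \<open>[X,Y]\<^sup>k = X(Y\<^sup>k) - Y(X\<^sup>k)\<close>, evaluated at \<open>p\<close> in the preferred chart at \<open>p\<close>.\<close>

definition lie_bracket ::
  "('p, 'e::euclidean_space) chart set \<Rightarrow> ('p \<Rightarrow> 'e) \<Rightarrow> ('p \<Rightarrow> 'e) \<Rightarrow> 'p \<Rightarrow> 'e" where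
  "lie_bracket A X Y p =
     dir_deriv A p (X p) (\<lambda>q. to_coord A (chart_at A p) q (Y q)) -
     dir_deriv A p (Y p) (\<lambda>q. to_coord A (chart_at A p) q (X q))"

definition smooth_map ::
  "('q::topological_space, 'm::euclidean_space) chart set \<Rightarrow>
   ('p::topological_space, 'e::euclidean_space) chart set \<Rightarrow> ('q \<Rightarrow> 'p) \<Rightarrow> bool" where
  "smooth_map A A' f \<longleftrightarrow> continuous_on UNIV f \<and>
     (\<forall>c\<in>A. \<forall>d\<in>A'. smooth_on (snd c ` (fst c \<inter> f -` fst d)) (snd d \<circ> f \<circ> chart_inv c))"

definition differential ::
  "('q, 'm::euclidean_space) chart set \<Rightarrow> ('p, 'e::euclidean_space) chart set \<Rightarrow>
   ('q \<Rightarrow> 'p) \<Rightarrow> 'q \<Rightarrow> 'm \<Rightarrow> 'e" where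
  "differential A A' f p v = dir_deriv A p v (\<lambda>q. snd (chart_at A' (f p)) (f q))"

definition smooth_immersion ::
  "('q::topological_space, 'm::euclidean_space) chart set \<Rightarrow>
   ('p::topological_space, 'e::euclidean_space) chart set \<Rightarrow> ('q \<Rightarrow> 'p) \<Rightarrow> bool" where
  "smooth_immersion A A' f \<longleftrightarrow> smooth_map A A' f \<and> (\<forall>p. inj (differential A A' f p))"

text \<open>
  A vector field along \<open>f\<close> assigns to \<open>p\<close> a tangent vector \<open>V p\<close> of the target manifold at \<open>f p\<close>.
\<close>

definition smooth_vf_along ::
  "('q, 'm::euclidean_space) chart set \<Rightarrow> ('p, 'e::euclidean_space) chart set \<Rightarrow>
   ('q \<Rightarrow> 'p) \<Rightarrow> ('q \<Rightarrow> 'e) \<Rightarrow> bool" where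
  "smooth_vf_along A A' f V \<longleftrightarrow>
     (\<forall>c\<in>A. \<forall>d\<in>A'. smooth_on (snd c ` (fst c \<inter> f -` fst d))
        ((\<lambda>p. to_coord A' d (f p) (V p)) \<circ> chart_inv c))"


section \<open>Distributions\<close>

definition smooth_distribution ::
  "('q::topological_space, 'm::euclidean_space) chart set \<Rightarrow> nat \<Rightarrow> ('q \<Rightarrow> 'm set) \<Rightarrow> bool" where
  "smooth_distribution A k S \<longleftrightarrow>
     (\<forall>p. \<exists>U E. open U \<and> p \<in> U \<and> (\<forall>i<k. smooth_vf_on A U (E i)) \<and>
        (\<forall>q\<in>U. S q = span ((\<lambda>i. E i q) ` {..<k}) \<and> dim (S q) = k))"

text \<open>
  A rank \<open>k\<close> distribution is integrable if through every point \<open>p\<close> there passes an integral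
  manifold. The integral manifold is given by a local parametrisation, defined on an open
  neighbourhood of \<open>0\<close> in a \<open>k\<close>-dimensional subspace \<open>L\<close> of the model space. In order to use
  derivatives in the full model space, the parametrisation \<open>h\<close> is taken to be defined on an open
  set \<open>W\<close> of the latter; only \<open>W \<inter> L\<close> matters (compose with a projection onto \<open>L\<close>).
\<close>

definition integrable_distribution ::
  "('q::topological_space, 'm::euclidean_space) chart set \<Rightarrow> nat \<Rightarrow> ('q \<Rightarrow> 'm set) \<Rightarrow> bool" where
  "integrable_distribution A k S \<longleftrightarrow>
     (\<forall>p. \<exists>(L::'m set) (W::'m set) (h::'m \<Rightarrow> 'q).
        subspace L \<and> dim L = k \<and> open W \<and> 0 \<in> W \<and> h 0 = p \<and>
        continuous_on W h \<and> (\<forall>c\<in>A. smooth_on (W \<inter> h -` fst c) (snd c \<circ> h)) \<and>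
        (\<forall>w \<in> W \<inter> L. frechet_derivative (snd (chart_at A (h w)) \<circ> h) (at w) ` L = S (h w)))"


section \<open>Lorentzian metrics and the Levi-Civita connection\<close>

definition smooth_metric ::
  "('p, 'e::euclidean_space) chart set \<Rightarrow> ('p \<Rightarrow> 'e \<Rightarrow> 'e \<Rightarrow> real) \<Rightarrow> bool" where
  "smooth_metric A g \<longleftrightarrow> (\<forall>c\<in>A. \<forall>u v. smooth_on (snd c ` fst c)
     ((\<lambda>p. g p (of_coord A c p u) (of_coord A c p v)) \<circ> chart_inv c))"

definition lorentzian_form :: "('e::euclidean_space \<Rightarrow> 'e \<Rightarrow> real) \<Rightarrow> bool" where
  "lorentzian_form b \<longleftrightarrow> bilinear b \<and> (\<forall>u v. b u v = b v u) \<and>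
     (\<exists>E e0. independent E \<and> span E = UNIV \<and> e0 \<in> E \<and>
        (\<forall>u\<in>E. \<forall>v\<in>E. b u v = (if u \<noteq> v then 0 else if u = e0 then -1 else 1)))"

definition lorentzian_metric ::
  "('p, 'e::euclidean_space) chart set \<Rightarrow> ('p \<Rightarrow> 'e \<Rightarrow> 'e \<Rightarrow> real) \<Rightarrow> bool" where
  "lorentzian_metric A g \<longleftrightarrow> smooth_metric A g \<and> (\<forall>p. lorentzian_form (g p))"

text \<open>
  An affine connection \<open>\<nabla>\<close> is given by its covariant derivatives \<open>nab p v Y\<close>, where \<open>v\<close> is a
  tangent vector at \<open>p\<close> and \<open>Y\<close> is a vector field defined and smooth near \<open>p\<close>. (As functions are
  total, \<open>Y\<close> is arbitrary elsewhere; the Leibniz rule for the function equal to \<open>1\<close> near \<open>p\<close> and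
  \<open>0\<close> elsewhere shows that \<open>nab p v Y\<close> only depends on \<open>Y\<close> near \<open>p\<close>.)
\<close>

definition affine_connection ::
  "('p::topological_space, 'e::euclidean_space) chart set \<Rightarrow>
   ('p \<Rightarrow> 'e \<Rightarrow> ('p \<Rightarrow> 'e) \<Rightarrow> 'e) \<Rightarrow> bool" where
  "affine_connection A nab \<longleftrightarrow>
     (\<forall>U p Y. open U \<and> p \<in> U \<and> smooth_vf_on A U Y \<longrightarrow> linear (\<lambda>v. nab p v Y)) \<and>
     (\<forall>U p v Y Y'. open U \<and> p \<in> U \<and> smooth_vf_on A U Y \<and> smooth_vf_on A U Y' \<longrightarrow>
        nab p v (\<lambda>q. Y q + Y' q) = nab p v Y + nab p v Y') \<and>
     (\<forall>U p v Y h. open U \<and> p \<in> U \<and> smooth_vf_on A U Y \<and> smooth_fun_on A U h \<longrightarrow>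
        nab p v (\<lambda>q. h q *\<^sub>R Y q) = dir_deriv A p v h *\<^sub>R Y p + h p *\<^sub>R nab p v Y) \<and>
     (\<forall>U X Y. open U \<and> smooth_vf_on A U X \<and> smooth_vf_on A U Y \<longrightarrow>
        smooth_vf_on A U (\<lambda>p. nab p (X p) Y))"

definition levi_civita ::
  "('p::topological_space, 'e::euclidean_space) chart set \<Rightarrow> ('p \<Rightarrow> 'e \<Rightarrow> 'e \<Rightarrow> real) \<Rightarrow>
   ('p \<Rightarrow> 'e \<Rightarrow> ('p \<Rightarrow> 'e) \<Rightarrow> 'e) \<Rightarrow> bool" where
  "levi_civita A g nab \<longleftrightarrow> affine_connection A nab \<and>
     (\<forall>U p X Y. open U \<and> p \<in> U \<and> smooth_vf_on A U X \<and> smooth_vf_on A U Y \<longrightarrow>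
        nab p (X p) Y - nab p (Y p) X = lie_bracket A X Y p) \<and>
     (\<forall>U p v X Y. open U \<and> p \<in> U \<and> smooth_vf_on A U X \<and> smooth_vf_on A U Y \<longrightarrow>
        dir_deriv A p v (\<lambda>q. g q (X q) (Y q)) = g p (nab p v X) (Y p) + g p (X p) (nab p v Y))"

text \<open>
  The covariant derivative at \<open>p\<close>, in the direction \<open>v\<close>, of a vector field \<open>V\<close> along \<open>f\<close> (the
  pullback connection). With \<open>\<partial>\<^sub>i\<close> the coordinate fields of the preferred chart at \<open>f p\<close> and
  \<open>V = \<Sum>\<^sub>i V\<^sup>i \<partial>\<^sub>i \<circ> f\<close> near \<open>p\<close>, it is \<open>\<Sum>\<^sub>i v(V\<^sup>i) \<partial>\<^sub>i + V\<^sup>i(p) \<nabla>\<^bsub>df(v)\<^esub> \<partial>\<^sub>i\<close>. At the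
  point \<open>f p\<close> itself \<open>\<partial>\<^sub>i\<close> is the basis vector \<open>i\<close> and \<open>V\<^sup>i(p) = V p \<bullet> i\<close>.
\<close>

definition cov_along ::
  "('q, 'm::euclidean_space) chart set \<Rightarrow> ('p, 'e::euclidean_space) chart set \<Rightarrow>
   ('p \<Rightarrow> 'e \<Rightarrow> ('p \<Rightarrow> 'e) \<Rightarrow> 'e) \<Rightarrow> ('q \<Rightarrow> 'p) \<Rightarrow> ('q \<Rightarrow> 'e) \<Rightarrow> 'q \<Rightarrow> 'm \<Rightarrow> 'e" where
  "cov_along A A' nab f V p v =
     (let d = chart_at A' (f p) in
      dir_deriv A p v (\<lambda>q. to_coord A' d (f q) (V q)) +
      (\<Sum>i\<in>Basis. (V p \<bullet> i) *\<^sub>R nab (f p) (differential A A' f p v) (\<lambda>r. of_coord A' d r i)))"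

text \<open>\<open>\<nabla>\<^bsub>X\<^esub>Z\<close> at \<open>p\<close> depends on \<open>X\<close> only through the tangent vector \<open>X p\<close>, here \<open>v\<close>.\<close>

definition closed_conformal ::
  "('p, 'e::euclidean_space) chart set \<Rightarrow> ('p \<Rightarrow> 'e \<Rightarrow> ('p \<Rightarrow> 'e) \<Rightarrow> 'e) \<Rightarrow>
   ('p \<Rightarrow> 'e) \<Rightarrow> ('p \<Rightarrow> real) \<Rightarrow> bool" where
  "closed_conformal A nab Z \<phi> \<longleftrightarrow> smooth_vf_on A UNIV Z \<and> smooth_fun_on A UNIV \<phi> \<and>
     (\<forall>p v. nab p v Z = \<phi> p *\<^sub>R v)"


section \<open>Null hypersurfaces\<close>

text \<open>
  Throughout, \<open>A\<close> is the atlas of \<open>M\<close>, \<open>A'\<close> the atlas of the ambient manifold, \<open>g\<close> and \<open>nab\<close> are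
  the ambient metric and connection, \<open>f\<close> is the immersion, and \<open>S\<close> is the screen distribution. The
  tangent space of \<open>M\<close> at \<open>p\<close> is not tacitly identified with its image under
  \<open>differential A A' f p\<close>, which is abbreviated by \<open>df\<close> in \<open>let\<close> expressions.
\<close>

definition radical ::
  "('q, 'm::euclidean_space) chart set \<Rightarrow> ('p, 'e::euclidean_space) chart set \<Rightarrow>
   ('p \<Rightarrow> 'e \<Rightarrow> 'e \<Rightarrow> real) \<Rightarrow> ('q \<Rightarrow> 'p) \<Rightarrow> 'q \<Rightarrow> 'm set" where
  "radical A A' g f p =
     {u. \<forall>v. g (f p) (differential A A' f p u) (differential A A' f p v) = 0}"

definition null_hypersurface ::
  "('q::topological_space, 'm::euclidean_space) chart set \<Rightarrow>
   ('p::topological_space, 'e::euclidean_space) chart set \<Rightarrow>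
   ('p \<Rightarrow> 'e \<Rightarrow> 'e \<Rightarrow> real) \<Rightarrow> ('q \<Rightarrow> 'p) \<Rightarrow> nat \<Rightarrow> ('q \<Rightarrow> 'm set) \<Rightarrow> bool" where
  "null_hypersurface A A' g f n S \<longleftrightarrow>
     DIM('e) = n + 2 \<and> DIM('m) = n + 1 \<and> smooth_immersion A A' f \<and>
     (\<forall>p. radical A A' g f p \<noteq> {0}) \<and>
     smooth_distribution A n S \<and>
     (\<forall>p. S p \<inter> radical A A' g f p = {0} \<and>
        (\<forall>v. \<exists>a \<in> S p. \<exists>b \<in> radical A A' g f p. v = a + b))"

definition null_frame ::
  "('q, 'm::euclidean_space) chart set \<Rightarrow> ('p, 'e::euclidean_space) chart set \<Rightarrow>
   ('p \<Rightarrow> 'e \<Rightarrow> 'e \<Rightarrow> real) \<Rightarrow> ('q \<Rightarrow> 'p) \<Rightarrow> ('q \<Rightarrow> 'm set) \<Rightarrow> ('q \<Rightarrow> 'm) \<Rightarrow> ('q \<Rightarrow> 'e) \<Rightarrow> bool" where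
  "null_frame A A' g f S \<xi> N \<longleftrightarrow>
     smooth_vf_on A UNIV \<xi> \<and> smooth_vf_along A A' f N \<and>
     (\<forall>p. let df = differential A A' f p in
        \<xi> p \<in> radical A A' g f p \<and> \<xi> p \<noteq> 0 \<and>
        g (f p) (df (\<xi> p)) (N p) = 1 \<and> g (f p) (N p) (N p) = 0 \<and>
        (\<forall>x \<in> S p. g (f p) (N p) (df x) = 0))"

text \<open>\<open>\<nabla>\<^bsub>v\<^esub>Y\<close>, the component tangent to \<open>M\<close> in \<open>TM \<oplus> span(N)\<close>.\<close>

definition induced_conn ::
  "('q, 'm::euclidean_space) chart set \<Rightarrow> ('p, 'e::euclidean_space) chart set \<Rightarrow>
   ('p \<Rightarrow> 'e \<Rightarrow> ('p \<Rightarrow> 'e) \<Rightarrow> 'e) \<Rightarrow> ('q \<Rightarrow> 'p) \<Rightarrow> ('q \<Rightarrow> 'e) \<Rightarrow> ('q \<Rightarrow> 'm) \<Rightarrow> 'q \<Rightarrow> 'm \<Rightarrow> 'm" where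
  "induced_conn A A' nab f N Y p v =
     (THE a. \<exists>b. cov_along A A' nab f (\<lambda>q. differential A A' f q (Y q)) p v =
        differential A A' f p a + b *\<^sub>R N p)"

text \<open>The shape operator \<open>A\<^sub>N\<close> and the one-form \<open>\<tau>\<close>.\<close>

definition shape_N ::
  "('q, 'm::euclidean_space) chart set \<Rightarrow> ('p, 'e::euclidean_space) chart set \<Rightarrow>
   ('p \<Rightarrow> 'e \<Rightarrow> ('p \<Rightarrow> 'e) \<Rightarrow> 'e) \<Rightarrow> ('q \<Rightarrow> 'p) \<Rightarrow> ('q \<Rightarrow> 'm set) \<Rightarrow> ('q \<Rightarrow> 'e) \<Rightarrow> 'q \<Rightarrow> 'm \<Rightarrow> 'm" where
  "shape_N A A' nab f S N p v =
     (THE a. a \<in> S p \<and>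
        (\<exists>t. cov_along A A' nab f N p v = - differential A A' f p a + t *\<^sub>R N p))"

definition rotation_form ::
  "('q, 'm::euclidean_space) chart set \<Rightarrow> ('p, 'e::euclidean_space) chart set \<Rightarrow>
   ('p \<Rightarrow> 'e \<Rightarrow> ('p \<Rightarrow> 'e) \<Rightarrow> 'e) \<Rightarrow> ('q \<Rightarrow> 'p) \<Rightarrow> ('q \<Rightarrow> 'm set) \<Rightarrow> ('q \<Rightarrow> 'e) \<Rightarrow> 'q \<Rightarrow> 'm \<Rightarrow> real" where
  "rotation_form A A' nab f S N p v =
     (THE t. \<exists>a \<in> S p. cov_along A A' nab f N p v = - differential A A' f p a + t *\<^sub>R N p)"

text \<open>The shape operator \<open>A\<^sup>*\<close> of \<open>\<xi>\<close>.\<close>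

definition shape_xi ::
  "('q, 'm::euclidean_space) chart set \<Rightarrow> ('p, 'e::euclidean_space) chart set \<Rightarrow>
   ('p \<Rightarrow> 'e \<Rightarrow> ('p \<Rightarrow> 'e) \<Rightarrow> 'e) \<Rightarrow> ('q \<Rightarrow> 'p) \<Rightarrow> ('q \<Rightarrow> 'm set) \<Rightarrow> ('q \<Rightarrow> 'm) \<Rightarrow> ('q \<Rightarrow> 'e) \<Rightarrow>
   'q \<Rightarrow> 'm \<Rightarrow> 'm" where
  "shape_xi A A' nab f S \<xi> N p v =
     (THE a. a \<in> S p \<and>
        induced_conn A A' nab f N \<xi> p v = - a - rotation_form A A' nab f S N p v *\<^sub>R \<xi> p)"

text \<open>The \<open>S(TM)\<close>-component of a vector field \<open>V\<close> along \<open>f\<close>.\<close>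

definition screen_part ::
  "('q, 'm::euclidean_space) chart set \<Rightarrow> ('p, 'e::euclidean_space) chart set \<Rightarrow>
   ('p \<Rightarrow> 'e \<Rightarrow> 'e \<Rightarrow> real) \<Rightarrow> ('q \<Rightarrow> 'p) \<Rightarrow> ('q \<Rightarrow> 'm set) \<Rightarrow> ('q \<Rightarrow> 'm) \<Rightarrow> ('q \<Rightarrow> 'e) \<Rightarrow>
   ('q \<Rightarrow> 'e) \<Rightarrow> 'q \<Rightarrow> 'm" where
  "screen_part A A' g f S \<xi> N V p =
     (let df = differential A A' f p in
      THE a. a \<in> S p \<and>
        V p = df a + g (f p) (V p) (N p) *\<^sub>R df (\<xi> p) + g (f p) (V p) (df (\<xi> p)) *\<^sub>R N p)"

text \<open>The operator \<open>A\<close> associated with the component of \<open>V\<close> in \<open>span(\<xi>) \<oplus> span(N)\<close>.\<close>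

definition shape_perp ::
  "('q, 'm::euclidean_space) chart set \<Rightarrow> ('p, 'e::euclidean_space) chart set \<Rightarrow>
   ('p \<Rightarrow> 'e \<Rightarrow> 'e \<Rightarrow> real) \<Rightarrow> ('p \<Rightarrow> 'e \<Rightarrow> ('p \<Rightarrow> 'e) \<Rightarrow> 'e) \<Rightarrow> ('q \<Rightarrow> 'p) \<Rightarrow> ('q \<Rightarrow> 'm set) \<Rightarrow>
   ('q \<Rightarrow> 'm) \<Rightarrow> ('q \<Rightarrow> 'e) \<Rightarrow> ('q \<Rightarrow> 'e) \<Rightarrow> 'q \<Rightarrow> 'm \<Rightarrow> 'm" where
  "shape_perp A A' g nab f S \<xi> N V p x =
     g (f p) (V p) (N p) *\<^sub>R shape_xi A A' nab f S \<xi> N p x +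
     g (f p) (V p) (differential A A' f p (\<xi> p)) *\<^sub>R shape_N A A' nab f S N p x"

definition angle_xi ::
  "('q, 'm::euclidean_space) chart set \<Rightarrow> ('p, 'e::euclidean_space) chart set \<Rightarrow>
   ('p \<Rightarrow> 'e \<Rightarrow> 'e \<Rightarrow> real) \<Rightarrow> ('q \<Rightarrow> 'p) \<Rightarrow> ('q \<Rightarrow> 'e) \<Rightarrow> ('q \<Rightarrow> 'm) \<Rightarrow> 'q \<Rightarrow> real" where
  "angle_xi A A' g f V \<xi> p =
     g (f p) (V p) (differential A A' f p (\<xi> p)) / sqrt \<bar>g (f p) (V p) (V p)\<bar>"

definition angle_N ::
  "('p \<Rightarrow> 'e \<Rightarrow> 'e \<Rightarrow> real) \<Rightarrow> ('q \<Rightarrow> 'p) \<Rightarrow> ('q \<Rightarrow> 'e) \<Rightarrow> ('q \<Rightarrow> 'e) \<Rightarrow> 'q \<Rightarrow> real" where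
  "angle_N g f V N p = g (f p) (V p) (N p) / sqrt \<bar>g (f p) (V p) (V p)\<bar>"

definition nowhere_null ::
  "('p \<Rightarrow> 'e \<Rightarrow> 'e \<Rightarrow> real) \<Rightarrow> ('q \<Rightarrow> 'p) \<Rightarrow> ('q \<Rightarrow> 'e::euclidean_space) \<Rightarrow> bool" where
  "nowhere_null g f V \<longleftrightarrow> (\<forall>p. g (f p) (V p) (V p) \<noteq> 0)"

definition constant_angle ::
  "('q, 'm::euclidean_space) chart set \<Rightarrow> ('p, 'e::euclidean_space) chart set \<Rightarrow>
   ('p \<Rightarrow> 'e \<Rightarrow> 'e \<Rightarrow> real) \<Rightarrow> ('q \<Rightarrow> 'p) \<Rightarrow> ('q \<Rightarrow> 'm set) \<Rightarrow> ('q \<Rightarrow> 'e) \<Rightarrow> bool" where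
  "constant_angle A A' g f S V \<longleftrightarrow>
     (\<exists>\<xi> N. null_frame A A' g f S \<xi> N \<and>
        angle_xi A A' g f V \<xi> constant_on UNIV \<and> angle_N g f V N constant_on UNIV)"

definition canonical_principal_direction ::
  "('q, 'm::euclidean_space) chart set \<Rightarrow> ('p, 'e::euclidean_space) chart set \<Rightarrow>
   ('p \<Rightarrow> 'e \<Rightarrow> 'e \<Rightarrow> real) \<Rightarrow> ('p \<Rightarrow> 'e \<Rightarrow> ('p \<Rightarrow> 'e) \<Rightarrow> 'e) \<Rightarrow> ('q \<Rightarrow> 'p) \<Rightarrow> ('q \<Rightarrow> 'm set) \<Rightarrow>
   ('q \<Rightarrow> 'm) \<Rightarrow> ('q \<Rightarrow> 'e) \<Rightarrow> ('q \<Rightarrow> 'e) \<Rightarrow> bool" where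
  "canonical_principal_direction A A' g nab f S \<xi> N V \<longleftrightarrow>
     (\<exists>l :: 'q \<Rightarrow> real. smooth_fun_on A UNIV l \<and>
        (\<forall>p. let z = screen_part A A' g f S \<xi> N V p in
           shape_perp A A' g nab f S \<xi> N V p z = l p *\<^sub>R z))"

end

(* Write a = g(Z,N), b = g(Z,xi) and let z be the screen part of Z. For x in the screen, metric
   compatibility and nabla_x Z = phi x give g(A x, z) = - x(ab), where A is the shape operator of the
   normal part of Z: the cross terms cancel because g(nabla_x xi, N) + g(xi, nabla_x N) = 0.
   Constant angle means ab = C |g(Z,Z)| for any null frame, so that x(ab) = 2 C sgn(g(Z,Z)) phi g(x,z). Since the screen is integrable, A is symmetric on it, and g is
   nondegenerate on it; hence A z = - 2 C sgn(g(Z,Z)) phi z. *)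
theory Submission
  imports Defs
begin

text \<open>The chart that identifies a tangent space with the model space jumps from point to
  point. A derivative at a point is therefore computed in the one chart preferred there, and a
  covariant derivative becomes a coordinate derivative plus a Christoffel term. Metric compatibility
  is needed with the base point moving along an arbitrary map into the ambient manifold: a chart
  inverse followed by \<open>f\<close> gives x(ab), and an integral manifold \<open>h\<close> of the
  screen followed by \<open>f\<close> gives the symmetry of A. Integrability is available only
  through such parametrisations \<open>h\<close>, so this symmetry comes from the equality of mixed
  second derivatives of f o h, proved here from the recursive notion of smoothness, together with
  the symmetry of the Christoffel term. The constant C is the product of the two constant angles of
  one distinguished frame; a change of frame multiplies \<xi> by a function and N by its inverse,
  which preserves ab. The sign of g(Z,Z) is only locally constant, as M may be disconnected; this is
  enough for the eigenvalue to be smooth.\<close>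

section \<open>Calculus of smooth maps\<close>

lemma Ck_on_cong:
  assumes "open U" "\<And>x. x \<in> U \<Longrightarrow> h x = h' x" "Ck_on k U h"
  shows "Ck_on k U h'"
  using assms(2,3)
proof (induction k arbitrary: h h')
  case 0
  then show ?case by (metis Ck_on.simps(1) continuous_on_cong)
next
  case (Suc k)
  have d: "h differentiable (at x)" if "x \<in> U" for x
    using Suc.prems that by simp
  have d': "h' differentiable (at x)" if "x \<in> U" for x
    by (meson Suc.prems(1) assms(1) d[OF that] differentiable_def has_derivative_transform_within_open that)
  have "frechet_derivative h (at x) = frechet_derivative h' (at x)" if "x \<in> U" for x
    using frechet_derivative_transform_within_open[OF d[OF that] assms(1) that] Suc.prems(1) by blast
  then have "Ck_on k U (\<lambda>x. frechet_derivative h' (at x) v)" for v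
    using Suc.IH[of "\<lambda>x. frechet_derivative h (at x) v"] Suc.prems by simp
  then show ?case using d' by simp
qed

lemma Ck_on_mono: "Ck_on k U h \<Longrightarrow> V \<subseteq> U \<Longrightarrow> Ck_on k V h"
  by (induction k arbitrary: h) (auto intro: continuous_on_subset)

lemma Ck_on_local:
  assumes "\<And>x. x \<in> U \<Longrightarrow> \<exists>V. open V \<and> x \<in> V \<and> Ck_on k V h"
  shows "Ck_on k U h"
  using assms
proof (induction k arbitrary: h)
  case 0
  then show ?case
    by (metis Ck_on.simps(1) continuous_at_imp_continuous_on continuous_on_eq_continuous_at)
next
  case (Suc k)
  then show ?case by (metis Ck_on.simps(2))
qed

text \<open>The clause for \<open>Suc k\<close> mentions only derivatives, so lowering the order
  rests on differentiable maps being continuous. The product rule needs this, because one of its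
  factors stays undifferentiated.\<close>

lemma Ck_on_pred: "Ck_on (Suc k) U h \<Longrightarrow> Ck_on k U h"
proof (induction k arbitrary: h)
  case 0
  then show ?case
    by (simp add: continuous_at_imp_continuous_on differentiable_imp_continuous_within)
next
  case (Suc k)
  then show ?case by (metis Ck_on.simps(2))
qed

lemma Ck_on_const: "Ck_on k U (\<lambda>x. c)"
  by (induction k arbitrary: c) auto

lemma Ck_on_add: "open U \<Longrightarrow> Ck_on k U h \<Longrightarrow> Ck_on k U h' \<Longrightarrow> Ck_on k U (\<lambda>x. h x + h' x)"
proof (induction k arbitrary: h h')
  case 0
  then show ?case by (simp add: continuous_on_add)
next
  case (Suc k)
  have *: "frechet_derivative (\<lambda>x. h x + h' x) (at x) =
      (\<lambda>v. frechet_derivative h (at x) v + frechet_derivative h' (at x) v)" if "x \<in> U" for x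
    using Suc.prems that
    by (intro frechet_derivative_at[symmetric] has_derivative_add) (auto simp: frechet_derivative_works[symmetric])
  have "Ck_on k U (\<lambda>x. frechet_derivative (\<lambda>x. h x + h' x) (at x) v)" for v
    by (rule Ck_on_cong[OF Suc.prems(1) _ Suc.IH]) (use * Suc.prems in auto)
  then show ?case using Suc.prems by auto
qed

lemma Ck_on_bilinear:
  assumes "bounded_bilinear b" "open U"
  shows "Ck_on k U h \<Longrightarrow> Ck_on k U h' \<Longrightarrow> Ck_on k U (\<lambda>x. b (h x) (h' x))"
proof (induction k arbitrary: h h')
  case 0
  then show ?case by (simp add: bounded_bilinear.continuous_on[OF assms(1)])
next
  case (Suc k)
  have *: "((\<lambda>x. b (h x) (h' x)) has_derivative
      (\<lambda>v. b (h x) (frechet_derivative h' (at x) v) + b (frechet_derivative h (at x) v) (h' x))) (at x)"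
    if "x \<in> U" for x
    using Suc.prems that
    by (intro bounded_bilinear.FDERIV[OF assms(1)]) (auto simp: frechet_derivative_works[symmetric])
  have "Ck_on k U (\<lambda>x. frechet_derivative (\<lambda>x. b (h x) (h' x)) (at x) v)" for v
  proof (rule Ck_on_cong[OF assms(2)])
    show "Ck_on k U (\<lambda>x. b (h x) (frechet_derivative h' (at x) v) + b (frechet_derivative h (at x) v) (h' x))"
      using Suc.prems Ck_on_pred[OF Suc.prems(1)] Ck_on_pred[OF Suc.prems(2)]
      by (intro Ck_on_add[OF assms(2)] Suc.IH) auto
  qed (simp add: frechet_derivative_at[OF *, symmetric])
  then show ?case using * by (auto simp: differentiable_def)
qed

lemma Ck_on_sum:
  assumes "open U" "\<And>i. i \<in> I \<Longrightarrow> Ck_on k U (h i)"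
  shows "Ck_on k U (\<lambda>x. \<Sum>i\<in>I. h i x)"
  using assms(2) by (induction I rule: infinite_finite_induct) (auto intro: Ck_on_const Ck_on_add[OF assms(1)])

lemma Ck_on_linear:
  assumes "bounded_linear L" "open U" "Ck_on k U h"
  shows "Ck_on k U (\<lambda>x. L (h x))"
  using assms(3)
proof (induction k arbitrary: h)
  case 0
  then show ?case by (simp add: bounded_linear.continuous_on[OF assms(1)])
next
  case (Suc k)
  have *: "((\<lambda>x. L (h x)) has_derivative (\<lambda>v. L (frechet_derivative h (at x) v))) (at x)"
    if "x \<in> U" for x
    using Suc.prems that
    by (intro bounded_linear.has_derivative[OF assms(1)]) (auto simp: frechet_derivative_works[symmetric])
  have "Ck_on k U (\<lambda>x. frechet_derivative (\<lambda>x. L (h x)) (at x) v)" for v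
    by (rule Ck_on_cong[OF assms(2) _ Suc.IH[of "\<lambda>x. frechet_derivative h (at x) v"]])
      (use Suc.prems fun_cong[OF frechet_derivative_at[OF *]] in auto)
  then show ?case using * by (auto simp: differentiable_def)
qed

lemma linear_expand_Basis:
  assumes "linear L"
  shows "L v = (\<Sum>i\<in>Basis. (v \<bullet> i) *\<^sub>R L i)"
  by (metis (no_types, lifting) assms euclidean_representation linear_sum linear_cmul sum.cong)

text \<open>The chain rule puts a direction that varies with \<open>x\<close> into the derivative of
  \<open>h\<close>, whereas \<open>Ck_on\<close> speaks of fixed directions. Expanding it in
  \<open>Basis\<close> leaves fixed directions with coefficients of the required class; hence the
  Euclidean target of \<open>t\<close>.\<close>

lemma Ck_on_compose:
  fixes t :: "'a::real_normed_vector \<Rightarrow> 'b::euclidean_space"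
  assumes "open U" "open V" "\<And>x. x \<in> U \<Longrightarrow> t x \<in> V"
  shows "Ck_on k V h \<Longrightarrow> Ck_on k U t \<Longrightarrow> Ck_on k U (\<lambda>x. h (t x))"
proof (induction k arbitrary: h)
  case 0
  then show ?case by (auto intro!: continuous_on_compose2[of V h] assms)
next
  case (Suc k)
  have *: "((\<lambda>x. h (t x)) has_derivative
      (\<lambda>v. frechet_derivative h (at (t x)) (frechet_derivative t (at x) v))) (at x)"
    if "x \<in> U" for x
    using Suc.prems that assms(3)
    by (intro has_derivative_compose[of t _ x UNIV h]) (auto simp: frechet_derivative_works[symmetric])
  have "Ck_on k U (\<lambda>x. frechet_derivative (\<lambda>x. h (t x)) (at x) v)" for v
  proof (rule Ck_on_cong[OF assms(1)])
    show "Ck_on k U (\<lambda>x. \<Sum>i\<in>Basis. (frechet_derivative t (at x) v \<bullet> i) *\<^sub>R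
        frechet_derivative h (at (t x)) i)"
      using Suc.prems Ck_on_pred[OF Suc.prems(2)]
      by (intro Ck_on_sum[OF assms(1)] Ck_on_bilinear[OF bounded_bilinear_scaleR assms(1)]
          Ck_on_bilinear[OF bounded_bilinear_inner assms(1)] Ck_on_const Suc.IH) auto
    show "(\<Sum>i\<in>Basis. (frechet_derivative t (at x) v \<bullet> i) *\<^sub>R frechet_derivative h (at (t x)) i)
        = frechet_derivative (\<lambda>x. h (t x)) (at x) v" if "x \<in> U" for x
      using frechet_derivative_at[OF *[OF that], symmetric] that Suc.prems assms(3)
      by (simp add: linear_expand_Basis[OF linear_frechet_derivative, symmetric])
  qed
  then show ?case using * by (auto simp: differentiable_def)
qed

lemma smooth_on_cong:
  "open U \<Longrightarrow> (\<And>x. x \<in> U \<Longrightarrow> h x = h' x) \<Longrightarrow> smooth_on U h \<Longrightarrow> smooth_on U h'"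
  unfolding smooth_on_def using Ck_on_cong by blast

lemma smooth_on_mono: "smooth_on U h \<Longrightarrow> V \<subseteq> U \<Longrightarrow> smooth_on V h"
  unfolding smooth_on_def using Ck_on_mono by blast

lemma smooth_on_local:
  "(\<And>x. x \<in> U \<Longrightarrow> \<exists>V. open V \<and> x \<in> V \<and> smooth_on V h) \<Longrightarrow> smooth_on U h"
  unfolding smooth_on_def by (metis Ck_on_local)

lemma smooth_on_const: "smooth_on U (\<lambda>x. c)"
  unfolding smooth_on_def using Ck_on_const by blast

lemma smooth_on_add: "open U \<Longrightarrow> smooth_on U h \<Longrightarrow> smooth_on U h' \<Longrightarrow> smooth_on U (\<lambda>x. h x + h' x)"
  unfolding smooth_on_def using Ck_on_add by blast

lemma smooth_on_scaleR:
  "open U \<Longrightarrow> smooth_on U h \<Longrightarrow> smooth_on U h' \<Longrightarrow> smooth_on U (\<lambda>x. h x *\<^sub>R h' x)"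
  unfolding smooth_on_def using Ck_on_bilinear[OF bounded_bilinear_scaleR] by blast

lemma smooth_on_linear:
  "bounded_linear L \<Longrightarrow> open U \<Longrightarrow> smooth_on U h \<Longrightarrow> smooth_on U (\<lambda>x. L (h x))"
  unfolding smooth_on_def using Ck_on_linear by blast

lemma smooth_on_compose:
  fixes t :: "'a::real_normed_vector \<Rightarrow> 'b::euclidean_space"
  assumes "open U" "open V" "\<And>x. x \<in> U \<Longrightarrow> t x \<in> V" "smooth_on V h" "smooth_on U t"
  shows "smooth_on U (\<lambda>x. h (t x))"
  using assms(4,5) Ck_on_compose[OF assms(1,2), of t] assms(3) unfolding smooth_on_def by blast

lemma smooth_on_differentiable: "smooth_on U h \<Longrightarrow> x \<in> U \<Longrightarrow> h differentiable (at x)"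
  unfolding smooth_on_def by (metis Ck_on.simps(2))

lemma smooth_on_has_derivative:
  "smooth_on U h \<Longrightarrow> x \<in> U \<Longrightarrow> (h has_derivative frechet_derivative h (at x)) (at x)"
  using smooth_on_differentiable frechet_derivative_works by blast

lemma smooth_on_derivative: "smooth_on U h \<Longrightarrow> smooth_on U (\<lambda>x. frechet_derivative h (at x) v)"
  unfolding smooth_on_def by (metis Ck_on.simps(2))

lemma smooth_on_derivative_field:
  fixes h :: "'a::euclidean_space \<Rightarrow> 'b::real_normed_vector"
  assumes "open U" "smooth_on U h" "smooth_on U v"
  shows "smooth_on U (\<lambda>x. frechet_derivative h (at x) (v x))"
proof (rule smooth_on_cong[OF assms(1)])
  show "smooth_on U (\<lambda>x. \<Sum>i\<in>Basis. (v x \<bullet> i) *\<^sub>R frechet_derivative h (at x) i)"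
    using assms smooth_on_derivative[OF assms(2)] unfolding smooth_on_def
    by (intro allI Ck_on_sum Ck_on_bilinear[OF bounded_bilinear_scaleR]
        Ck_on_bilinear[OF bounded_bilinear_inner] Ck_on_const) auto
qed (simp add: linear_expand_Basis[OF linear_frechet_derivative, symmetric]
      smooth_on_differentiable[OF assms(2)])

section \<open>Symmetry of second derivatives, and derivatives along lines\<close>

lemma second_difference:
  fixes h :: "'a::real_normed_vector \<Rightarrow> real"
  assumes "open U" "Ck_on 2 U h" "0 < s"
    and U: "\<And>a b. 0 \<le> a \<Longrightarrow> a \<le> s \<Longrightarrow> 0 \<le> b \<Longrightarrow> b \<le> s \<Longrightarrow> x + a *\<^sub>R u + b *\<^sub>R v \<in> U"
  shows "\<exists>a b. 0 < a \<and> a < s \<and> 0 < b \<and> b < s \<and>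
    h (x + s *\<^sub>R u + s *\<^sub>R v) - h (x + s *\<^sub>R u) - h (x + s *\<^sub>R v) + h x =
    s * s * frechet_derivative (\<lambda>y. frechet_derivative h (at y) u) (at (x + a *\<^sub>R u + b *\<^sub>R v)) v"
proof -
  define hu where "hu = (\<lambda>y. frechet_derivative h (at y) u)"
  have d: "(h has_derivative frechet_derivative h (at y)) (at y)"
      and du: "(hu has_derivative frechet_derivative hu (at y)) (at y)" if "y \<in> U" for y
    using assms(2) that by (auto simp: numeral_2_eq_2 hu_def frechet_derivative_works[symmetric])
  have 1: "((\<lambda>a. h (x + a *\<^sub>R u + s *\<^sub>R v) - h (x + a *\<^sub>R u)) has_derivative
      (\<lambda>r. r * (hu (x + a *\<^sub>R u + s *\<^sub>R v) - hu (x + a *\<^sub>R u)))) (at a)" if "0 \<le> a" "a \<le> s" for a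
  proof -
    have in_U: "x + a *\<^sub>R u + s *\<^sub>R v \<in> U" "x + a *\<^sub>R u \<in> U"
      using U[OF that, of s] U[OF that, of 0] assms(3) by auto
    have lin: "frechet_derivative h (at y) (r *\<^sub>R u) = r * hu y" if "y \<in> U" for y r
      using linear_cmul[OF linear_frechet_derivative[OF differentiableI[OF d[OF that]]]]
      by (simp add: hu_def)
    show ?thesis
      by (rule has_derivative_eq_rhs[OF has_derivative_diff[OF
              has_derivative_compose[of "\<lambda>a. x + a *\<^sub>R u + s *\<^sub>R v" "\<lambda>r. r *\<^sub>R u", OF _ d]
              has_derivative_compose[of "\<lambda>a. x + a *\<^sub>R u" "\<lambda>r. r *\<^sub>R u", OF _ d]]])
        (use in_U lin in_U[unfolded add.assoc] lin[OF in_U(1)[unfolded add.assoc]] in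
          \<open>auto intro!: derivative_eq_intros simp: algebra_simps\<close>)
  qed
  \<comment> \<open>The second difference is the increment over [0, s] of h(x + a u + s v) - h(x + a
    u) as a function of a. The mean value theorem in a, and below in b, turns it into a second
    derivative at an interior point.\<close>
  have "\<exists>a. 0 < a \<and> a < s \<and> (h (x + s *\<^sub>R u + s *\<^sub>R v) - h (x + s *\<^sub>R u)) - (h (x + v') - h x)
      = s * (hu (x + a *\<^sub>R u + s *\<^sub>R v) - hu (x + a *\<^sub>R u))" if "v' = s *\<^sub>R v" for v'
    using mvt[OF assms(3), of "\<lambda>a. h (x + a *\<^sub>R u + s *\<^sub>R v) - h (x + a *\<^sub>R u)"
        "\<lambda>a r. r * (hu (x + a *\<^sub>R u + s *\<^sub>R v) - hu (x + a *\<^sub>R u))"] 1 that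
    by (smt (verit) add.right_neutral atLeastAtMost_iff continuous_at_imp_continuous_on diff_zero
        has_derivative_continuous scaleR_zero_left)
  then obtain a where a: "0 < a" "a < s" and
    ea: "(h (x + s *\<^sub>R u + s *\<^sub>R v) - h (x + s *\<^sub>R u)) - (h (x + s *\<^sub>R v) - h x)
      = s * (hu (x + a *\<^sub>R u + s *\<^sub>R v) - hu (x + a *\<^sub>R u))" by blast
  have 2: "((\<lambda>b. hu (x + a *\<^sub>R u + b *\<^sub>R v)) has_derivative
      (\<lambda>r. r * frechet_derivative hu (at (x + a *\<^sub>R u + b *\<^sub>R v)) v)) (at b)" if "0 \<le> b" "b \<le> s" for b
  proof -
    have in_U: "x + a *\<^sub>R u + b *\<^sub>R v \<in> U" using U that a by simp
    show ?thesis
      by (rule has_derivative_eq_rhs[OF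
            has_derivative_compose[of "\<lambda>b. x + a *\<^sub>R u + b *\<^sub>R v" "\<lambda>r. r *\<^sub>R v", OF _ du[OF in_U]]])
        (auto intro!: derivative_eq_intros
          simp: linear_cmul[OF linear_frechet_derivative[OF differentiableI[OF du[OF in_U]]]])
  qed
  obtain b where "0 < b" "b < s" "hu (x + a *\<^sub>R u + s *\<^sub>R v) - hu (x + a *\<^sub>R u + 0 *\<^sub>R v)
      = s * frechet_derivative hu (at (x + a *\<^sub>R u + b *\<^sub>R v)) v"
    using mvt[OF assms(3), of "\<lambda>b. hu (x + a *\<^sub>R u + b *\<^sub>R v)"
        "\<lambda>b r. r * frechet_derivative hu (at (x + a *\<^sub>R u + b *\<^sub>R v)) v"] 2
    by (smt (verit) atLeastAtMost_iff continuous_at_imp_continuous_on has_derivative_continuous diff_zero)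
  then show ?thesis
    using a ea by (intro exI[of _ a] exI[of _ b]) (simp add: hu_def[symmetric])
qed

text \<open>Exchanging \<open>u\<close> and \<open>v\<close> leaves the second difference over a
  small parallelogram at \<open>x\<close> unchanged, and \<open>second_difference\<close> equates it
  with s^2 times either mixed derivative at some point of the parallelogram. Continuity at
  \<open>x\<close> then excludes a gap between the two values.\<close>

lemma second_derivative_symmetric_real:
  fixes h :: "'a::real_normed_vector \<Rightarrow> real"
  assumes "open U" "Ck_on 2 U h" "x \<in> U"
  shows "frechet_derivative (\<lambda>y. frechet_derivative h (at y) u) (at x) v =
    frechet_derivative (\<lambda>y. frechet_derivative h (at y) v) (at x) u" (is "?D u v x = ?D v u x")
proof (rule ccontr)
  assume ne: "?D u v x \<noteq> ?D v u x"
  define e where "e = \<bar>?D u v x - ?D v u x\<bar> / 2"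
  have "e > 0" using ne by (simp add: e_def)
  have "isCont (?D u v) x" for u v
    using assms by (auto simp: numeral_2_eq_2 continuous_on_eq_continuous_at)
  then have cont: "(?D u v \<longlongrightarrow> ?D u v x) (nhds x)" for u v
    unfolding isCont_def using tendsto_at_iff_tendsto_nhds[of "?D u v" x] by blast
  have ev: "\<forall>\<^sub>F y in nhds x. y \<in> U \<and> \<bar>?D u v y - ?D u v x\<bar> < e \<and> \<bar>?D v u y - ?D v u x\<bar> < e"
    using tendstoD[OF cont[of u v] \<open>e > 0\<close>] tendstoD[OF cont[of v u] \<open>e > 0\<close>]
      eventually_nhds_in_open[OF assms(1,3)]
    unfolding dist_real_def by (intro eventually_conj)
  obtain r where r: "r > 0" "\<And>y. dist y x < r \<Longrightarrow>
      y \<in> U \<and> \<bar>?D u v y - ?D u v x\<bar> < e \<and> \<bar>?D v u y - ?D v u x\<bar> < e"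
    using ev unfolding eventually_nhds_metric by blast
  \<comment> \<open>This side length keeps the parallelogram within distance r/2 of
    \<open>x\<close>; the summand 1 covers u = v = 0.\<close>
  define s where "s = r / (2 * (norm u + norm v + 1))"
  have pos: "norm u + norm v + 1 > 0" by (smt (verit) norm_ge_zero)
  have "s > 0" using r pos by (simp add: s_def)
  have near: "dist (x + a *\<^sub>R u + b *\<^sub>R v) x < r" if "0 \<le> a" "a \<le> s" "0 \<le> b" "b \<le> s" for a b
  proof -
    have "dist (x + a *\<^sub>R u + b *\<^sub>R v) x \<le> norm (a *\<^sub>R u) + norm (b *\<^sub>R v)"
      using norm_triangle_ineq[of "a *\<^sub>R u" "b *\<^sub>R v"] by (simp add: dist_norm add.assoc)
    also have "\<dots> \<le> s * norm u + s * norm v"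
      using that by (simp add: add_mono mult_right_mono)
    also have "\<dots> < s * (2 * (norm u + norm v + 1))"
      using \<open>s > 0\<close> pos by (simp add: algebra_simps add_pos_nonneg add_nonneg_pos)
    also have "\<dots> = r" using pos by (simp add: s_def)
    finally show ?thesis .
  qed
  have near': "dist (x + b *\<^sub>R v + a *\<^sub>R u) x < r" if "0 \<le> a" "a \<le> s" "0 \<le> b" "b \<le> s" for a b
    using near[OF that] by (simp add: algebra_simps)
  obtain a b where 1: "0 < a" "a < s" "0 < b" "b < s"
    "h (x + s *\<^sub>R u + s *\<^sub>R v) - h (x + s *\<^sub>R u) - h (x + s *\<^sub>R v) + h x =
     s * s * ?D u v (x + a *\<^sub>R u + b *\<^sub>R v)"
    using second_difference[OF assms(1,2) \<open>s > 0\<close>, of x u v] near r(2) by blast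
  obtain a' b' where 2: "0 < a'" "a' < s" "0 < b'" "b' < s"
    "h (x + s *\<^sub>R v + s *\<^sub>R u) - h (x + s *\<^sub>R v) - h (x + s *\<^sub>R u) + h x =
     s * s * ?D v u (x + a' *\<^sub>R v + b' *\<^sub>R u)"
    using second_difference[OF assms(1,2) \<open>s > 0\<close>, of x v u] near' r(2) by blast
  have comm: "x + s *\<^sub>R v + s *\<^sub>R u = x + s *\<^sub>R u + s *\<^sub>R v" by simp
  have "s * s * ?D u v (x + a *\<^sub>R u + b *\<^sub>R v) = s * s * ?D v u (x + a' *\<^sub>R v + b' *\<^sub>R u)"
    using 1(5) 2(5) unfolding comm by linarith
  then have eq: "?D u v (x + a *\<^sub>R u + b *\<^sub>R v) = ?D v u (x + a' *\<^sub>R v + b' *\<^sub>R u)"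
    using \<open>s > 0\<close> by simp
  have "\<bar>?D u v (x + a *\<^sub>R u + b *\<^sub>R v) - ?D u v x\<bar> < e"
    using r(2)[OF near[of a b]] 1 by simp
  moreover have "\<bar>?D v u (x + a' *\<^sub>R v + b' *\<^sub>R u) - ?D v u x\<bar> < e"
    using r(2)[OF near'[of b' a']] 2 by simp
  \<comment> \<open>The gap is 2 e, so no number is closer than e to both of its ends.\<close>
  moreover have False if "\<bar>p - a\<bar> < e" "\<bar>q - b\<bar> < e" "p = q" "e = \<bar>a - b\<bar> / 2" for p q a b e :: real
    using that abs_triangle_ineq4[of "p - b" "p - a"] by simp
  ultimately show False using eq e_def by blast
qed

text \<open>The mean value argument is confined to real functions, so it is applied to each
  coordinate function; the inner product with a basis vector commutes with both derivatives.\<close>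

lemma second_derivative_symmetric:
  fixes h :: "'a::real_normed_vector \<Rightarrow> 'b::euclidean_space"
  assumes "open U" "smooth_on U h" "x \<in> U"
  shows "frechet_derivative (\<lambda>y. frechet_derivative h (at y) u) (at x) v =
    frechet_derivative (\<lambda>y. frechet_derivative h (at y) v) (at x) u"
proof (rule euclidean_eqI)
  fix i :: 'b assume "i \<in> Basis"
  have bl: "bounded_linear (\<lambda>y::'b. y \<bullet> i)" by (rule bounded_linear_inner_left)
  have 1: "frechet_derivative (\<lambda>z. h z \<bullet> i) (at y) w = frechet_derivative h (at y) w \<bullet> i"
    if "y \<in> U" for y w
    using frechet_derivative_at[OF bounded_linear.has_derivative[OF bl
          smooth_on_has_derivative[OF assms(2) that]]] by metis
  have 2: "frechet_derivative (\<lambda>y. frechet_derivative (\<lambda>z. h z \<bullet> i) (at y) w) (at x) w' =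
      frechet_derivative (\<lambda>y. frechet_derivative h (at y) w) (at x) w' \<bullet> i" for w w'
  proof -
    have "((\<lambda>y. frechet_derivative h (at y) w \<bullet> i) has_derivative
        (\<lambda>w'. frechet_derivative (\<lambda>y. frechet_derivative h (at y) w) (at x) w' \<bullet> i)) (at x)"
      using smooth_on_has_derivative[OF smooth_on_derivative[OF assms(2)] assms(3)]
      by (rule bounded_linear.has_derivative[OF bl])
    then have "((\<lambda>y. frechet_derivative (\<lambda>z. h z \<bullet> i) (at y) w) has_derivative
        (\<lambda>w'. frechet_derivative (\<lambda>y. frechet_derivative h (at y) w) (at x) w' \<bullet> i)) (at x)"
      by (rule has_derivative_transform_within_open[OF _ assms(1,3)]) (simp add: 1)
    from frechet_derivative_at[OF this] show ?thesis by metis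
  qed
  have "smooth_on U (\<lambda>z. h z \<bullet> i)" by (rule smooth_on_linear[OF bl assms(1,2)])
  then have "Ck_on 2 U (\<lambda>z. h z \<bullet> i)" unfolding smooth_on_def by blast
  from second_derivative_symmetric_real[OF assms(1) this assms(3), of u v]
  show "frechet_derivative (\<lambda>y. frechet_derivative h (at y) u) (at x) v \<bullet> i =
    frechet_derivative (\<lambda>y. frechet_derivative h (at y) v) (at x) u \<bullet> i"
    unfolding 2 .
qed

lemma has_derivative_abs_nonzero:
  fixes a :: real
  assumes "a \<noteq> 0"
  shows "(abs has_derivative (\<lambda>x. sgn a * x)) (at a)"
proof (rule has_derivative_transform_within_open)
  show "((\<lambda>x. sgn a * x) has_derivative (\<lambda>x. sgn a * x)) (at a)"
    by (intro derivative_intros)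
  show "open {x. sgn a * x > 0}" by (intro open_Collect_less continuous_intros)
  show "a \<in> {x. sgn a * x > 0}" using assms by (simp add: abs_sgn[symmetric] mult.commute)
  show "sgn a * x = \<bar>x\<bar>" if "x \<in> {x. sgn a * x > 0}" for x
    using that by (auto simp: sgn_if split: if_splits)
qed

text \<open>Only values on one line through 0 are constrained, so only its direction is concluded.
  This suits integral manifolds, whose parametrisation has a meaning on a subspace only.\<close>

lemma derivative_zero_on_line:
  fixes h :: "'a::real_normed_vector \<Rightarrow> 'b::real_normed_vector"
  assumes "(h has_derivative D) (at 0)" "open W" "0 \<in> W" "\<And>t::real. t *\<^sub>R u \<in> W \<Longrightarrow> h (t *\<^sub>R u) = 0"
  shows "D u = 0"
proof -
  have 1: "((\<lambda>t::real. h (t *\<^sub>R u)) has_derivative (\<lambda>t. D (t *\<^sub>R u))) (at 0)"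
    by (rule has_derivative_compose[of "\<lambda>t. t *\<^sub>R u" "\<lambda>t. t *\<^sub>R u"])
      (use assms(1) in \<open>auto intro!: derivative_eq_intros\<close>)
  have "open ((\<lambda>t::real. t *\<^sub>R u) -` W)"
    by (intro open_vimage assms(2) continuous_intros)
  then have "((\<lambda>t::real. h (t *\<^sub>R u)) has_derivative (\<lambda>t. 0)) (at 0)"
    by (rule has_derivative_transform_within_open[OF has_derivative_const]) (use assms in auto)
  from fun_cong[OF has_derivative_unique[OF 1 this], of 1] show ?thesis by simp
qed

section \<open>Charts and coordinates\<close>

locale smooth_manifold =
  fixes A :: "('p::topological_space, 'e::euclidean_space) chart set"
  assumes atlas: "smooth_atlas A"
begin

lemma chart_at_mem [simp]: "chart_at A p \<in> A" and in_chart_at [simp]: "p \<in> fst (chart_at A p)"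
proof -
  have "\<exists>c. c \<in> A \<and> p \<in> fst c" using atlas unfolding smooth_atlas_def by blast
  then have "chart_at A p \<in> A \<and> p \<in> fst (chart_at A p)" unfolding chart_at_def by (rule someI_ex)
  then show "chart_at A p \<in> A" "p \<in> fst (chart_at A p)" by auto
qed

lemma is_chart: "c \<in> A \<Longrightarrow> is_chart c"
  using atlas unfolding smooth_atlas_def by blast

lemma open_chart [simp]: "c \<in> A \<Longrightarrow> open (fst c)"
  using is_chart unfolding is_chart_def by blast

lemma chart_inv_left [simp]: "c \<in> A \<Longrightarrow> p \<in> fst c \<Longrightarrow> chart_inv c (snd c p) = p"
  using is_chart[of c] unfolding is_chart_def homeomorphism_def by blast

lemma chart_inv_right [simp]: "c \<in> A \<Longrightarrow> y \<in> snd c ` fst c \<Longrightarrow> snd c (chart_inv c y) = y"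
  using is_chart[of c] unfolding is_chart_def homeomorphism_def by blast

lemma chart_inv_in [simp]: "c \<in> A \<Longrightarrow> y \<in> snd c ` fst c \<Longrightarrow> chart_inv c y \<in> fst c"
  by auto

lemma continuous_chart_inv: "c \<in> A \<Longrightarrow> continuous_on (snd c ` fst c) (chart_inv c)"
  using is_chart[of c] unfolding is_chart_def homeomorphism_def by blast

lemma open_chart_image:
  assumes "c \<in> A" "open U"
  shows "open (snd c ` (fst c \<inter> U))"
proof -
  have "snd c ` (fst c \<inter> U) = snd c ` fst c \<inter> chart_inv c -` U"
    using assms(1) by (auto simp: image_iff)
  moreover have "open (snd c ` fst c)" using is_chart[OF assms(1)] unfolding is_chart_def by blast
  ultimately show ?thesis
    using continuous_open_preimage[OF continuous_chart_inv[OF assms(1)] _ assms(2)] by simp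
qed

lemma isCont_chart_inv:
  assumes "c \<in> A" "p \<in> fst c"
  shows "isCont (chart_inv c) (snd c p)"
  using continuous_chart_inv[OF assms(1)] open_chart_image[OF assms(1) open_UNIV] assms(2)
  by (simp add: continuous_on_eq_continuous_at)

lemma eventually_chart_inv:
  assumes "c \<in> A" "p \<in> fst c" "open U" "p \<in> U"
  shows "\<forall>\<^sub>F y in nhds (snd c p). y \<in> snd c ` (fst c \<inter> U)"
  using eventually_nhds_in_open[OF open_chart_image[OF assms(1,3)]] assms by blast

lemma smooth_transition:
  "c \<in> A \<Longrightarrow> d \<in> A \<Longrightarrow> smooth_on (snd c ` (fst c \<inter> fst d)) (snd d \<circ> chart_inv c)"
  using atlas unfolding smooth_atlas_def by blast

abbreviation transD :: "('p, 'e) chart \<Rightarrow> ('p, 'e) chart \<Rightarrow> 'p \<Rightarrow> 'e \<Rightarrow> 'e" where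
  "transD c d p \<equiv> frechet_derivative (snd d \<circ> chart_inv c) (at (snd c p))"

lemma transition_has_derivative:
  assumes "c \<in> A" "d \<in> A" "p \<in> fst c" "p \<in> fst d"
  shows "(snd d \<circ> chart_inv c has_derivative transD c d p) (at (snd c p))"
  by (rule smooth_on_has_derivative[OF smooth_transition[OF assms(1,2)]]) (use assms in auto)

lemma linear_transD: "c \<in> A \<Longrightarrow> d \<in> A \<Longrightarrow> p \<in> fst c \<Longrightarrow> p \<in> fst d \<Longrightarrow> linear (transD c d p)"
  using transition_has_derivative by (rule has_derivative_linear)

text \<open>This is the chain rule for the transition map. \<open>F\<close> has to stay in the
  domain of \<open>c\<close> near \<open>x\<close>, since elsewhere \<open>snd c\<close> is
  arbitrary. \<open>F\<close> may start from any normed space, so that chart inverses and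
  parametrised integral manifolds are both covered.\<close>

lemma change_chart:
  assumes "c \<in> A" "d \<in> A" "F x \<in> fst c" "F x \<in> fst d" "\<forall>\<^sub>F y in nhds x. F y \<in> fst c"
    and "((\<lambda>y. snd c (F y)) has_derivative D) (at x)"
  shows "((\<lambda>y. snd d (F y)) has_derivative (\<lambda>v. transD c d (F x) (D v))) (at x)"
proof -
  have "((\<lambda>y. (snd d \<circ> chart_inv c) (snd c (F y))) has_derivative (\<lambda>v. transD c d (F x) (D v))) (at x)"
    using has_derivative_compose[OF assms(6), of "snd d \<circ> chart_inv c"]
      transition_has_derivative[OF assms(1-4)] by simp
  then show ?thesis
    by (rule has_derivative_transform_eventually)
      (use assms in \<open>auto simp: eventually_at_filter elim!: eventually_mono\<close>)
qed

lemma transD_cocycle: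
  assumes "c \<in> A" "d \<in> A" "e \<in> A" "p \<in> fst c" "p \<in> fst d" "p \<in> fst e"
  shows "transD d e p (transD c d p v) = transD c e p v"
proof -
  have ev: "\<forall>\<^sub>F y in nhds (snd c p). chart_inv c y \<in> fst d"
    using eventually_chart_inv[OF assms(1,4), of "fst d"] assms by (auto elim!: eventually_mono)
  have "((\<lambda>y. snd e (chart_inv c y)) has_derivative (\<lambda>v. transD d e p (transD c d p v))) (at (snd c p))"
    using change_chart[of d e "chart_inv c" "snd c p"] ev transition_has_derivative[of c d p] assms
    by (simp add: o_def)
  from frechet_derivative_at[OF this] show ?thesis by (simp add: o_def fun_eq_iff)
qed

lemma transD_same:
  assumes "c \<in> A" "p \<in> fst c"
  shows "transD c c p v = v"
proof -
  have "(snd c \<circ> chart_inv c has_derivative (\<lambda>v. v)) (at (snd c p))"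
    by (rule has_derivative_transform_within_open[OF has_derivative_ident open_chart_image[OF assms(1) open_UNIV]])
      (use assms in auto)
  from frechet_derivative_at[OF this] show ?thesis by metis
qed

text \<open>A tangent vector at \<open>p\<close> is by convention its own component vector in the
  preferred chart, so passing to components in \<open>c\<close> is a transition Jacobian. The laws
  of \<open>to_coord\<close> and \<open>of_coord\<close> thereby reduce to the cocycle rule.\<close>

lemma to_coord_eq: "to_coord A c p v = transD (chart_at A p) c p v"
  unfolding to_coord_def dir_deriv_def by simp

lemma of_coord_eq: "of_coord A c p v = transD c (chart_at A p) p v"
  unfolding of_coord_def by simp

lemma to_coord_of_coord:
  "c \<in> A \<Longrightarrow> d \<in> A \<Longrightarrow> p \<in> fst c \<Longrightarrow> p \<in> fst d \<Longrightarrow> to_coord A d p (of_coord A c p v) = transD c d p v"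
  by (simp add: to_coord_eq of_coord_eq transD_cocycle)

lemma to_coord_of_coord_same [simp]: "c \<in> A \<Longrightarrow> p \<in> fst c \<Longrightarrow> to_coord A c p (of_coord A c p v) = v"
  by (simp add: to_coord_of_coord transD_same)

lemma of_coord_to_coord [simp]: "c \<in> A \<Longrightarrow> p \<in> fst c \<Longrightarrow> of_coord A c p (to_coord A c p v) = v"
  by (simp add: to_coord_eq of_coord_eq transD_cocycle transD_same)

lemma to_coord_chart_at [simp]: "to_coord A (chart_at A p) p v = v"
  by (simp add: to_coord_eq transD_same)

lemma of_coord_chart_at [simp]: "of_coord A (chart_at A p) p v = v"
  by (simp add: of_coord_eq transD_same)

lemma linear_to_coord: "c \<in> A \<Longrightarrow> p \<in> fst c \<Longrightarrow> linear (to_coord A c p)"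
  using linear_transD[of "chart_at A p" c p] by (simp add: to_coord_eq[abs_def])

lemma linear_of_coord: "c \<in> A \<Longrightarrow> p \<in> fst c \<Longrightarrow> linear (of_coord A c p)"
  using linear_transD[of c "chart_at A p" p] by (simp add: of_coord_eq[abs_def])

lemma of_coord_expand:
  "c \<in> A \<Longrightarrow> p \<in> fst c \<Longrightarrow> v = (\<Sum>i\<in>Basis. (to_coord A c p v \<bullet> i) *\<^sub>R of_coord A c p i)"
  by (metis linear_expand_Basis linear_of_coord of_coord_to_coord)

section \<open>Smooth functions and vector fields read in charts\<close>

lemma smooth_fun_on_chart:
  assumes "d \<in> A" "smooth_on (snd d ` fst d) k"
  shows "smooth_fun_on A (fst d) (\<lambda>p. k (snd d p))"
  unfolding smooth_fun_on_def
proof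
  fix c assume c: "c \<in> A"
  have "smooth_on (snd c ` (fst c \<inter> fst d)) (\<lambda>y. k ((snd d \<circ> chart_inv c) y))"
    by (rule smooth_on_compose[OF open_chart_image[OF c open_chart[OF assms(1)]]
          open_chart_image[OF assms(1) open_UNIV] _ _ smooth_transition[OF c assms(1)]])
      (use assms c in auto)
  then show "smooth_on (snd c ` (fst c \<inter> fst d)) ((\<lambda>p. k (snd d p)) \<circ> chart_inv c)"
    by (simp add: o_def)
qed

text \<open>In another chart \<open>c\<close> the field is the Jacobian of the transition from
  \<open>d\<close> to \<open>c\<close>, applied to the fixed vector \<open>u\<close> and precomposed
  with the transition from \<open>c\<close> to \<open>d\<close>.\<close>

lemma smooth_coordinate_field:
  assumes "d \<in> A"
  shows "smooth_vf_on A (fst d) (\<lambda>p. of_coord A d p u)"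
  unfolding smooth_vf_on_def
proof
  fix c assume c: "c \<in> A"
  let ?U = "snd c ` (fst c \<inter> fst d)" let ?V = "snd d ` (fst d \<inter> fst c)"
  have U: "open ?U" "open ?V" using open_chart_image assms c by auto
  have "smooth_on ?U (\<lambda>y. frechet_derivative (snd c \<circ> chart_inv d) (at ((snd d \<circ> chart_inv c) y)) u)"
    by (rule smooth_on_compose[OF U _ smooth_on_derivative[OF smooth_transition[OF assms c]]
          smooth_transition[OF c assms]]) (use assms c in auto)
  then show "smooth_on ?U ((\<lambda>p. to_coord A c p (of_coord A d p u)) \<circ> chart_inv c)"
    by (rule smooth_on_cong[OF U(1), rotated]) (use assms c in \<open>auto simp: to_coord_of_coord\<close>)
qed

lemma smooth_vf_on_add:
  assumes "open U" "smooth_vf_on A U X" "smooth_vf_on A U Y"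
  shows "smooth_vf_on A U (\<lambda>p. X p + Y p)"
  unfolding smooth_vf_on_def
proof
  fix c assume c: "c \<in> A"
  show "smooth_on (snd c ` (fst c \<inter> U)) ((\<lambda>p. to_coord A c p (X p + Y p)) \<circ> chart_inv c)"
    by (rule smooth_on_cong[OF open_chart_image[OF c assms(1)] _
          smooth_on_add[OF open_chart_image[OF c assms(1)]
            assms(2)[unfolded smooth_vf_on_def, rule_format, OF c]
            assms(3)[unfolded smooth_vf_on_def, rule_format, OF c]]])
      (use c in \<open>auto simp: linear_add[OF linear_to_coord]\<close>)
qed

lemma smooth_vf_on_scale:
  assumes "open U" "smooth_fun_on A U h" "smooth_vf_on A U X"
  shows "smooth_vf_on A U (\<lambda>p. h p *\<^sub>R X p)"
  unfolding smooth_vf_on_def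
proof
  fix c assume c: "c \<in> A"
  show "smooth_on (snd c ` (fst c \<inter> U)) ((\<lambda>p. to_coord A c p (h p *\<^sub>R X p)) \<circ> chart_inv c)"
    by (rule smooth_on_cong[OF open_chart_image[OF c assms(1)] _
          smooth_on_scaleR[OF open_chart_image[OF c assms(1)]
            assms(2)[unfolded smooth_fun_on_def, rule_format, OF c]
            assms(3)[unfolded smooth_vf_on_def, rule_format, OF c]]])
      (use c in \<open>auto simp: linear_cmul[OF linear_to_coord]\<close>)
qed

lemma smooth_vf_on_zero: "open U \<Longrightarrow> smooth_vf_on A U (\<lambda>p. 0)"
  unfolding smooth_vf_on_def
proof
  fix c assume "open U" "c \<in> A"
  then show "smooth_on (snd c ` (fst c \<inter> U)) ((\<lambda>p. to_coord A c p 0) \<circ> chart_inv c)"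
    by (intro smooth_on_cong[OF open_chart_image _ smooth_on_const[of _ 0]])
      (auto simp: linear_0[OF linear_to_coord])
qed

lemma smooth_vf_on_sum:
  assumes "open U" "\<And>i. i \<in> I \<Longrightarrow> smooth_vf_on A U (X i)"
  shows "smooth_vf_on A U (\<lambda>p. \<Sum>i\<in>I. X i p)"
  using assms(2)
  by (induction I rule: infinite_finite_induct)
    (auto intro: smooth_vf_on_zero[OF assms(1)] smooth_vf_on_add[OF assms(1)])

lemma smooth_vf_on_mono:
  assumes "smooth_vf_on A U X" "V \<subseteq> U"
  shows "smooth_vf_on A V X"
  unfolding smooth_vf_on_def
proof
  fix c assume "c \<in> A"
  then show "smooth_on (snd c ` (fst c \<inter> V)) ((\<lambda>p. to_coord A c p (X p)) \<circ> chart_inv c)"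
    using assms unfolding smooth_vf_on_def by (blast intro: smooth_on_mono)
qed

lemma smooth_vf_on_cong:
  assumes "open U" "\<And>p. p \<in> U \<Longrightarrow> X p = Y p" "smooth_vf_on A U X"
  shows "smooth_vf_on A U Y"
  unfolding smooth_vf_on_def
proof
  fix c assume c: "c \<in> A"
  show "smooth_on (snd c ` (fst c \<inter> U)) ((\<lambda>p. to_coord A c p (Y p)) \<circ> chart_inv c)"
    by (rule smooth_on_cong[OF open_chart_image[OF c assms(1)] _
          assms(3)[unfolded smooth_vf_on_def, rule_format, OF c]])
      (use c assms(2) in auto)
qed

lemma dir_deriv_eq:
  assumes "((h \<circ> chart_inv (chart_at A p)) has_derivative D) (at (snd (chart_at A p) p))"
  shows "dir_deriv A p v h = D v"
  unfolding dir_deriv_def using frechet_derivative_at[OF assms] by simp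

lemma dir_deriv_const_near:
  assumes "open U" "p \<in> U" "\<And>q. q \<in> U \<Longrightarrow> h q = k"
  shows "dir_deriv A p v h = 0"
proof -
  let ?c = "chart_at A p"
  have "((h \<circ> chart_inv ?c) has_derivative (\<lambda>v. 0)) (at (snd ?c p))"
    by (rule has_derivative_transform_within_open[OF has_derivative_const[of k] open_chart_image[of ?c U]])
      (use assms in auto)
  from dir_deriv_eq[OF this] show ?thesis .
qed

end

section \<open>The Levi-Civita connection in coordinates\<close>

locale levi_civita_manifold = smooth_manifold A
  for A :: "('p::topological_space, 'e::euclidean_space) chart set" +
  fixes g :: "'p \<Rightarrow> 'e \<Rightarrow> 'e \<Rightarrow> real" and nab :: "'p \<Rightarrow> 'e \<Rightarrow> ('p \<Rightarrow> 'e) \<Rightarrow> 'e"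
  assumes metric: "smooth_metric A g"
    and bilinear_g: "\<And>p. bilinear (g p)"
    and g_sym: "\<And>p u v. g p u v = g p v u"
    and levi_civita: "levi_civita A g nab"
begin

lemma linear_g: "linear (g p u)"
  using bilinear_g[of p] unfolding bilinear_def by blast

lemma linear_g_left: "linear (\<lambda>u. g p u v)"
  using bilinear_g[of p] unfolding bilinear_def by blast

lemma g_simps [simp]:
  "g p (u + v) w = g p u w + g p v w" "g p w (u + v) = g p w u + g p w v"
  "g p (u - v) w = g p u w - g p v w" "g p w (u - v) = g p w u - g p w v"
  "g p (r *\<^sub>R u) w = r * g p u w" "g p w (r *\<^sub>R u) = r * g p w u"
  "g p (- u) w = - g p u w" "g p w (- u) = - g p w u"
  "g p 0 w = 0" "g p w 0 = 0"
  using linear_add[OF linear_g_left] linear_add[OF linear_g] linear_diff[OF linear_g_left]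
    linear_diff[OF linear_g] linear_cmul[OF linear_g_left] linear_cmul[OF linear_g]
    linear_neg[OF linear_g_left] linear_neg[OF linear_g] linear_0[OF linear_g_left] linear_0[OF linear_g]
  by auto

lemma g_sum: "g p (\<Sum>i\<in>I. a i) w = (\<Sum>i\<in>I. g p (a i) w)" "g p w (\<Sum>i\<in>I. a i) = (\<Sum>i\<in>I. g p w (a i))"
  by (rule linear_sum[OF linear_g_left], rule linear_sum[OF linear_g])

lemma g_sum_sum: "g p (\<Sum>i\<in>I. a i) (\<Sum>j\<in>J. b j) = (\<Sum>i\<in>I. \<Sum>j\<in>J. g p (a i) (b j))"
  by (simp only: g_sum(1), simp only: g_sum(2))

lemma affine: "affine_connection A nab"
  using levi_civita unfolding levi_civita_def by blast

lemma nab_linear: "open U \<Longrightarrow> p \<in> U \<Longrightarrow> smooth_vf_on A U Y \<Longrightarrow> linear (\<lambda>v. nab p v Y)"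
  using affine[unfolded affine_connection_def, THEN conjunct1, rule_format, of U p Y] by simp

lemma nab_add: "open U \<Longrightarrow> p \<in> U \<Longrightarrow> smooth_vf_on A U Y \<Longrightarrow> smooth_vf_on A U Y' \<Longrightarrow>
    nab p v (\<lambda>q. Y q + Y' q) = nab p v Y + nab p v Y'"
  using affine[unfolded affine_connection_def, THEN conjunct2, THEN conjunct1,
      rule_format, of U p Y Y' v] by simp

lemma nab_scale: "open U \<Longrightarrow> p \<in> U \<Longrightarrow> smooth_vf_on A U Y \<Longrightarrow> smooth_fun_on A U h \<Longrightarrow>
    nab p v (\<lambda>q. h q *\<^sub>R Y q) = dir_deriv A p v h *\<^sub>R Y p + h p *\<^sub>R nab p v Y"
  using affine[unfolded affine_connection_def, THEN conjunct2, THEN conjunct2, THEN conjunct1,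
      rule_format, of U p Y h v] by simp

section \<open>Locality and finite sums for the connection\<close>

lemma smooth_fun_on_indicator: "open U \<Longrightarrow> smooth_fun_on A U (\<lambda>q. if q \<in> U then 1 else (0::real))"
  unfolding smooth_fun_on_def
proof
  fix c assume "open U" "c \<in> A"
  then show "smooth_on (snd c ` (fst c \<inter> U)) ((\<lambda>q. if q \<in> U then 1 else (0::real)) \<circ> chart_inv c)"
    by (intro smooth_on_cong[OF open_chart_image _ smooth_on_const[of _ 1]]) auto
qed

lemma nab_restrict:
  assumes "open U" "p \<in> U" "smooth_vf_on A U Y"
  shows "nab p v (\<lambda>q. (if q \<in> U then 1 else (0::real)) *\<^sub>R Y q) = nab p v Y"
  using nab_scale[OF assms smooth_fun_on_indicator[OF assms(1)], of v]
    dir_deriv_const_near[OF assms(1,2), of "\<lambda>q. if q \<in> U then 1 else (0::real)" 1 v] assms(2)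
  by simp

text \<open>\<open>nab\<close> takes total functions, and fields that agree on \<open>U\<close> may
  differ elsewhere. Multiplied by the indicator of \<open>U\<close> they become equal as functions,
  and by the Leibniz rule this factor, constant near \<open>p\<close>, does not affect the
  derivative there.\<close>

lemma nab_cong:
  assumes "open U" "p \<in> U" "smooth_vf_on A U Y" "\<And>q. q \<in> U \<Longrightarrow> Y q = Y' q"
  shows "nab p v Y = nab p v Y'"
proof -
  have "(\<lambda>q. (if q \<in> U then 1 else (0::real)) *\<^sub>R Y q) = (\<lambda>q. (if q \<in> U then 1 else (0::real)) *\<^sub>R Y' q)"
    using assms(4) by auto
  then show ?thesis
    using nab_restrict[OF assms(1-3)] nab_restrict[OF assms(1,2) smooth_vf_on_cong[OF assms(1,4,3)]]
    by metis
qed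

lemma nab_zero:
  assumes "open U" "p \<in> U"
  shows "nab p v (\<lambda>q. 0) = 0"
  using nab_add[OF assms smooth_vf_on_zero[OF assms(1)] smooth_vf_on_zero[OF assms(1)], of v] by simp

lemma nab_sum:
  assumes "open U" "p \<in> U" "\<And>i. i \<in> I \<Longrightarrow> smooth_vf_on A U (X i)"
  shows "nab p v (\<lambda>q. \<Sum>i\<in>I. X i q) = (\<Sum>i\<in>I. nab p v (X i))"
  using assms(3)
  by (induction I rule: infinite_finite_induct)
    (simp_all add: nab_zero[OF assms(1,2)] nab_add[OF assms(1,2)] smooth_vf_on_sum[OF assms(1)])

text \<open>This is the sum of \<Gamma>^k_ij w^i u^j in the preferred chart at \<open>p\<close>,
  that is, the derivative in direction \<open>w\<close> of the field with constant components
  \<open>u\<close>. It is evaluated only at \<open>p\<close>, where the coordinate fields are the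
  basis vectors themselves.\<close>

definition christoffel :: "'p \<Rightarrow> 'e \<Rightarrow> 'e \<Rightarrow> 'e" where
  "christoffel p w u = (\<Sum>i\<in>Basis. (u \<bullet> i) *\<^sub>R nab p w (\<lambda>r. of_coord A (chart_at A p) r i))"

lemma linear_nab_coordinate: "linear (\<lambda>w. nab p w (\<lambda>r. of_coord A (chart_at A p) r i))"
  by (rule nab_linear[OF _ _ smooth_coordinate_field]) auto

lemma christoffel_Basis:
  assumes "j \<in> Basis"
  shows "christoffel p w j = nab p w (\<lambda>r. of_coord A (chart_at A p) r j)"
proof -
  have "christoffel p w j = (\<Sum>i\<in>Basis. if i = j then nab p w (\<lambda>r. of_coord A (chart_at A p) r i) else 0)"
    unfolding christoffel_def using assms by (intro sum.cong) (auto simp: inner_Basis)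
  then show ?thesis using assms by simp
qed

lemma linear_christoffel_left: "linear (\<lambda>w. christoffel p w u)"
  unfolding christoffel_def
  by (intro linear_compose_sum ballI linear_compose_scale_right linear_nab_coordinate)

lemma linear_christoffel: "linear (christoffel p w)"
  by (rule linearI) (auto simp: christoffel_def inner_add_left scaleR_add_left sum.distrib scaleR_sum_right)

text \<open>Coordinate fields have constant components in their own chart, so their bracket
  vanishes, and the connection has no torsion.\<close>

lemma christoffel_sym_Basis:
  assumes "i \<in> Basis" "j \<in> Basis"
  shows "christoffel p i j = christoffel p j i"
proof -
  let ?d = "chart_at A p"
  let ?X = "\<lambda>i r. of_coord A ?d r i"
  have "nab p (?X i p) (?X j) - nab p (?X j p) (?X i) = lie_bracket A (?X i) (?X j) p"
    using levi_civita open_chart[of ?d] smooth_coordinate_field[of ?d] in_chart_at[of p]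
    unfolding levi_civita_def by (meson chart_at_mem)
  also have "\<dots> = 0"
    unfolding lie_bracket_def
    by (subst (1 2) dir_deriv_const_near[of "fst ?d"]) auto
  finally show ?thesis using assms by (simp add: christoffel_Basis)
qed

lemma christoffel_sym: "christoffel p u v = christoffel p v u"
proof -
  have "christoffel p u v = (\<Sum>i\<in>Basis. \<Sum>j\<in>Basis. (u \<bullet> i) *\<^sub>R (v \<bullet> j) *\<^sub>R christoffel p i j)" for u v
  proof -
    have "christoffel p u v = (\<Sum>i\<in>Basis. (u \<bullet> i) *\<^sub>R christoffel p i v)"
      by (rule linear_expand_Basis[OF linear_christoffel_left])
    also have "\<dots> = (\<Sum>i\<in>Basis. (u \<bullet> i) *\<^sub>R (\<Sum>j\<in>Basis. (v \<bullet> j) *\<^sub>R christoffel p i j))"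
      by (simp only: linear_expand_Basis[OF linear_christoffel, symmetric])
    finally show ?thesis by (simp only: scaleR_sum_right)
  qed
  note expand = this
  have "christoffel p u v = (\<Sum>i\<in>Basis. \<Sum>j\<in>Basis. (v \<bullet> j) *\<^sub>R (u \<bullet> i) *\<^sub>R christoffel p j i)"
    unfolding expand[of u v]
    by (intro sum.cong refl) (simp add: christoffel_sym_Basis mult.commute)
  also have "\<dots> = christoffel p v u"
    unfolding expand[of v u] by (rule sum.swap)
  finally show ?thesis .
qed

text \<open>On the chart domain \<open>Z\<close> is a combination of coordinate fields with smooth
  coefficients; additivity and the Leibniz rule split its derivative into derivatives of the
  coefficients and the Christoffel term.\<close>

lemma nab_coordinates:
  assumes "smooth_vf_on A UNIV Z"
    and "((\<lambda>y. to_coord A (chart_at A p) (chart_inv (chart_at A p) y) (Z (chart_inv (chart_at A p) y)))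
      has_derivative D) (at (snd (chart_at A p) p))"
  shows "nab p w Z = D w + christoffel p w (Z p)"
proof -
  let ?d = "chart_at A p"
  let ?U = "fst ?d"
  define k where "k = (\<lambda>y. to_coord A ?d (chart_inv ?d y) (Z (chart_inv ?d y)))"
  have U: "open ?U" "p \<in> ?U" by auto
  have ks: "smooth_on (snd ?d ` ?U) k"
    using assms(1) chart_at_mem[of p] unfolding smooth_vf_on_def k_def o_def by fastforce
  define h where "h = (\<lambda>i q. k (snd ?d q) \<bullet> i)"
  have hs: "smooth_fun_on A ?U (h i)" for i
    using smooth_fun_on_chart[of ?d "\<lambda>y. k y \<bullet> i"]
      smooth_on_linear[OF bounded_linear_inner_left _ ks] open_chart_image[of ?d UNIV]
    by (simp add: h_def)
  have exp: "Z q = (\<Sum>i\<in>Basis. h i q *\<^sub>R of_coord A ?d q i)" if "q \<in> ?U" for q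
    using of_coord_expand[of ?d q "Z q"] that by (simp add: h_def k_def)
  have hd: "dir_deriv A p w (h i) = D w \<bullet> i" for i
  proof (rule dir_deriv_eq[where D = "\<lambda>w. D w \<bullet> i"])
    have "((\<lambda>y. k y \<bullet> i) has_derivative (\<lambda>w. D w \<bullet> i)) (at (snd ?d p))"
      using assms(2) unfolding k_def by (rule bounded_linear.has_derivative[OF bounded_linear_inner_left])
    then show "(h i \<circ> chart_inv ?d has_derivative (\<lambda>w. D w \<bullet> i)) (at (snd ?d p))"
      by (rule has_derivative_transform_within_open[OF _ open_chart_image[of ?d UNIV]])
        (auto simp: h_def)
  qed
  have "nab p w Z = nab p w (\<lambda>q. \<Sum>i\<in>Basis. h i q *\<^sub>R of_coord A ?d q i)"
    by (rule nab_cong[OF U smooth_vf_on_mono[OF assms(1)] exp]) auto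
  also have "\<dots> = (\<Sum>i\<in>Basis. nab p w (\<lambda>q. h i q *\<^sub>R of_coord A ?d q i))"
    by (rule nab_sum[OF U smooth_vf_on_scale[OF U(1) hs smooth_coordinate_field]]) auto
  also have "\<dots> = (\<Sum>i\<in>Basis. (D w \<bullet> i) *\<^sub>R i + h i p *\<^sub>R nab p w (\<lambda>q. of_coord A ?d q i))"
    by (simp add: nab_scale[OF U smooth_coordinate_field hs] hd)
  also have "\<dots> = D w + christoffel p w (Z p)"
    by (simp add: sum.distrib euclidean_representation christoffel_def h_def k_def)
  finally show ?thesis .
qed

text \<open>Metric compatibility is applied to two coordinate fields; the derivatives of the metric
  along maps follow from this case by the product rule.\<close>

lemma metric_coefficient_derivative:
  assumes "i \<in> Basis" "j \<in> Basis"
  shows "((\<lambda>y. g (chart_inv (chart_at A p) y) (of_coord A (chart_at A p) (chart_inv (chart_at A p) y) i)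
      (of_coord A (chart_at A p) (chart_inv (chart_at A p) y) j))
    has_derivative (\<lambda>w. g p (christoffel p w i) j + g p i (christoffel p w j))) (at (snd (chart_at A p) p))"
proof -
  let ?d = "chart_at A p"
  let ?X = "\<lambda>i r. of_coord A ?d r i"
  let ?G = "(\<lambda>q. g q (?X i q) (?X j q)) \<circ> chart_inv ?d"
  have "smooth_on (snd ?d ` fst ?d) ?G"
    using metric unfolding smooth_metric_def by simp
  then have D: "(?G has_derivative frechet_derivative ?G (at (snd ?d p))) (at (snd ?d p))"
    by (rule smooth_on_has_derivative) simp
  have "dir_deriv A p w (\<lambda>q. g q (?X i q) (?X j q)) =
      g p (nab p w (?X i)) (?X j p) + g p (?X i p) (nab p w (?X j))" for w
    using levi_civita open_chart[of ?d] smooth_coordinate_field[of ?d] in_chart_at[of p]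
    unfolding levi_civita_def by (meson chart_at_mem)
  then have "frechet_derivative ?G (at (snd ?d p)) = (\<lambda>w. g p (christoffel p w i) j + g p i (christoffel p w j))"
    using assms by (simp add: dir_deriv_def christoffel_Basis fun_eq_iff)
  with D show ?thesis by (simp add: o_def)
qed

text \<open>The domain of \<open>F\<close> need not be a chart of \<open>M\<close>: it may also parametrise an integral manifold of
  the screen distribution.\<close>

lemma metric_along_has_derivative:
  fixes F :: "'x::real_normed_vector \<Rightarrow> 'p"
  assumes F: "\<forall>\<^sub>F y in nhds x. F y \<in> fst (chart_at A (F x))"
      "((\<lambda>y. snd (chart_at A (F x)) (F y)) has_derivative F') (at x)"
    and V: "((\<lambda>y. to_coord A (chart_at A (F x)) (F y) (V y)) has_derivative V') (at x)"
    and W: "((\<lambda>y. to_coord A (chart_at A (F x)) (F y) (W y)) has_derivative W') (at x)"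
  shows "((\<lambda>y. g (F y) (V y) (W y)) has_derivative
    (\<lambda>u. g (F x) (V' u + christoffel (F x) (F' u) (V x)) (W x) +
      g (F x) (V x) (W' u + christoffel (F x) (F' u) (W x)))) (at x)"
proof -
  let ?p = "F x"
  let ?d = "chart_at A ?p"
  define G where "G = (\<lambda>i j y. g (chart_inv ?d y) (of_coord A ?d (chart_inv ?d y) i) (of_coord A ?d (chart_inv ?d y) j))"
  define Vc where "Vc = (\<lambda>y. to_coord A ?d (F y) (V y))"
  define Wc where "Wc = (\<lambda>y. to_coord A ?d (F y) (W y))"
  have at_x: "Vc x = V x" "Wc x = W x" "G i j (snd ?d ?p) = g ?p i j" for i j
    by (auto simp: Vc_def Wc_def G_def)
  have dG: "((\<lambda>y. G i j (snd ?d (F y))) has_derivative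
      (\<lambda>u. g ?p (christoffel ?p (F' u) i) j + g ?p i (christoffel ?p (F' u) j))) (at x)"
    if "i \<in> Basis" "j \<in> Basis" for i j
    using has_derivative_compose[OF F(2)] metric_coefficient_derivative[OF that, of ?p]
    by (simp add: G_def)
  \<comment> \<open>Each summand is a product of three real functions of y: a component of
    \<open>V\<close>, a component of \<open>W\<close> and a metric coefficient pulled back along
    \<open>F\<close>. Hence \<open>V\<close> and \<open>W\<close> need not be extended to ambient
    fields.\<close>
  have "((\<lambda>y. \<Sum>i\<in>Basis. \<Sum>j\<in>Basis. (Vc y \<bullet> i) * (Wc y \<bullet> j) * G i j (snd ?d (F y))) has_derivative
      (\<lambda>u. \<Sum>i\<in>Basis. \<Sum>j\<in>Basis. (Vc x \<bullet> i) * (Wc x \<bullet> j) *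
          (g ?p (christoffel ?p (F' u) i) j + g ?p i (christoffel ?p (F' u) j)) +
        ((Vc x \<bullet> i) * (W' u \<bullet> j) + (V' u \<bullet> i) * (Wc x \<bullet> j)) * G i j (snd ?d ?p))) (at x)"
    using V W unfolding Vc_def[symmetric] Wc_def[symmetric]
    by (intro has_derivative_sum has_derivative_mult dG
        bounded_linear.has_derivative[OF bounded_linear_inner_left])
  then have "((\<lambda>y. g (F y) (V y) (W y)) has_derivative
      (\<lambda>u. \<Sum>i\<in>Basis. \<Sum>j\<in>Basis. (Vc x \<bullet> i) * (Wc x \<bullet> j) *
          (g ?p (christoffel ?p (F' u) i) j + g ?p i (christoffel ?p (F' u) j)) +
        ((Vc x \<bullet> i) * (W' u \<bullet> j) + (V' u \<bullet> i) * (Wc x \<bullet> j)) * G i j (snd ?d ?p))) (at x)"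
  proof (rule has_derivative_transform_eventually)
    have "(\<Sum>i\<in>Basis. \<Sum>j\<in>Basis. (Vc y \<bullet> i) * (Wc y \<bullet> j) * G i j (snd ?d (F y))) = g (F y) (V y) (W y)"
      if "F y \<in> fst ?d" for y
    proof -
      have "g (F y) (V y) (W y) = g (F y) (\<Sum>i\<in>Basis. (Vc y \<bullet> i) *\<^sub>R of_coord A ?d (F y) i)
          (\<Sum>j\<in>Basis. (Wc y \<bullet> j) *\<^sub>R of_coord A ?d (F y) j)"
        using of_coord_expand[of ?d "F y" "V y"] of_coord_expand[of ?d "F y" "W y"] that
        by (simp add: Vc_def Wc_def)
      then show ?thesis
        using that by (simp add: g_sum_sum mult_ac G_def)
    qed
    then show "\<forall>\<^sub>F y in at x. (\<Sum>i\<in>Basis. \<Sum>j\<in>Basis. (Vc y \<bullet> i) * (Wc y \<bullet> j) * G i j (snd ?d (F y)))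
        = g (F y) (V y) (W y)"
      using F(1) by (auto simp: eventually_at_filter elim!: eventually_mono)
    then show "(\<Sum>i\<in>Basis. \<Sum>j\<in>Basis. (Vc x \<bullet> i) * (Wc x \<bullet> j) * G i j (snd ?d (F x))) = g (F x) (V x) (W x)"
      using \<open>\<And>y. F y \<in> fst ?d \<Longrightarrow> _\<close> by simp
  qed simp
  \<comment> \<open>Summed up by bilinearity, the derivatives of the metric coefficients supply
    exactly the Christoffel terms that complete \<open>V'\<close> and \<open>W'\<close> to covariant
    derivatives.\<close>
  moreover have "(\<Sum>i\<in>Basis. \<Sum>j\<in>Basis. (Vc x \<bullet> i) * (Wc x \<bullet> j) *
          (g ?p (christoffel ?p (F' u) i) j + g ?p i (christoffel ?p (F' u) j)) +
        ((Vc x \<bullet> i) * (W' u \<bullet> j) + (V' u \<bullet> i) * (Wc x \<bullet> j)) * G i j (snd ?d ?p)) =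
      g ?p (V' u + christoffel ?p (F' u) (V x)) (W x) +
      g ?p (V x) (W' u + christoffel ?p (F' u) (W x))" (is "?L = _") for u
  proof -
    have expand: "g ?p (L a) (M b) = (\<Sum>i\<in>Basis. \<Sum>j\<in>Basis. (a \<bullet> i) * (b \<bullet> j) * g ?p (L i) (M j))"
      if "linear L" "linear M" for a b and L M :: "'e \<Rightarrow> 'e"
      using linear_expand_Basis[OF that(1), of a] linear_expand_Basis[OF that(2), of b]
      by (simp add: g_sum_sum mult_ac)
    have id: "linear (\<lambda>v::'e. v)" by (simp add: linear_iff)
    have "g ?p (christoffel ?p (F' u) (V x)) (W x) =
        (\<Sum>i\<in>Basis. \<Sum>j\<in>Basis. (V x \<bullet> i) * (W x \<bullet> j) * g ?p (christoffel ?p (F' u) i) j)"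
      "g ?p (V x) (christoffel ?p (F' u) (W x)) =
        (\<Sum>i\<in>Basis. \<Sum>j\<in>Basis. (V x \<bullet> i) * (W x \<bullet> j) * g ?p i (christoffel ?p (F' u) j))"
      "g ?p (V' u) (W x) = (\<Sum>i\<in>Basis. \<Sum>j\<in>Basis. (V' u \<bullet> i) * (W x \<bullet> j) * g ?p i j)"
      "g ?p (V x) (W' u) = (\<Sum>i\<in>Basis. \<Sum>j\<in>Basis. (V x \<bullet> i) * (W' u \<bullet> j) * g ?p i j)"
      by (rule expand[OF linear_christoffel id] expand[OF id linear_christoffel] expand[OF id id])+
    then have "?L = g ?p (christoffel ?p (F' u) (V x)) (W x) + g ?p (V x) (christoffel ?p (F' u) (W x)) +
        (g ?p (V x) (W' u) + g ?p (V' u) (W x))"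
      by (simp only: at_x sum.distrib[symmetric] distrib_left distrib_right add.assoc)
    then show ?thesis by simp
  qed
  ultimately show ?thesis by simp
qed

end

section \<open>Vector fields along an immersion\<close>

locale immersed_manifold = M: smooth_manifold A + levi_civita_manifold A' g nab
  for A :: "('q::topological_space, 'm::euclidean_space) chart set"
    and A' :: "('p::topological_space, 'e::euclidean_space) chart set"
    and g :: "'p \<Rightarrow> 'e \<Rightarrow> 'e \<Rightarrow> real" and nab :: "'p \<Rightarrow> 'e \<Rightarrow> ('p \<Rightarrow> 'e) \<Rightarrow> 'e" +
  fixes f :: "'q \<Rightarrow> 'p"
  assumes immersion: "smooth_immersion A A' f"
begin

abbreviation df :: "'q \<Rightarrow> 'm \<Rightarrow> 'e" where "df \<equiv> differential A A' f"
abbreviation cov :: "('q \<Rightarrow> 'e) \<Rightarrow> 'q \<Rightarrow> 'm \<Rightarrow> 'e" where "cov \<equiv> cov_along A A' nab f"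
abbreviation along :: "('q \<Rightarrow> 'e) \<Rightarrow> bool" where "along \<equiv> smooth_vf_along A A' f"

lemma inj_df: "inj (df p)"
  using immersion unfolding smooth_immersion_def by blast

lemma continuous_f: "continuous_on UNIV f"
  using immersion unfolding smooth_immersion_def smooth_map_def by blast

lemma open_vimage_chart: "d \<in> A' \<Longrightarrow> open (f -` fst d)"
  using continuous_f open_vimage[of "fst d" f] by simp

lemma smooth_f:
  "c \<in> A \<Longrightarrow> d \<in> A' \<Longrightarrow> smooth_on (snd c ` (fst c \<inter> f -` fst d)) (\<lambda>y. snd d (f (chart_inv c y)))"
  using immersion unfolding smooth_immersion_def smooth_map_def o_def by blast

lemma open_f_chart: "c \<in> A \<Longrightarrow> d \<in> A' \<Longrightarrow> open (snd c ` (fst c \<inter> f -` fst d))"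
  by (intro M.open_chart_image open_vimage_chart)

section \<open>Chain rules and the pullback connection\<close>

lemma f_has_derivative:
  "((\<lambda>y. snd (chart_at A' (f p)) (f (chart_inv (chart_at A p) y))) has_derivative df p)
    (at (snd (chart_at A p) p))"
proof -
  have "df p = frechet_derivative (\<lambda>y. snd (chart_at A' (f p)) (f (chart_inv (chart_at A p) y)))
      (at (snd (chart_at A p) p))"
    unfolding differential_def dir_deriv_def o_def by (simp add: fun_eq_iff)
  then show ?thesis
    using smooth_on_has_derivative[OF smooth_f[of "chart_at A p" "chart_at A' (f p)"]] by simp
qed

lemma linear_df: "linear (df p)"
  using f_has_derivative by (rule has_derivative_linear)

text \<open>Near \<open>x\<close> the map f o k factors through the preferred chart at
  \<open>k x\<close>, to which \<open>k'\<close> refers; the chain rule applies there, and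
  \<open>change_chart\<close> passes to \<open>d\<close>.\<close>

lemma f_chain:
  fixes k :: "'x::real_normed_vector \<Rightarrow> 'q"
  assumes "isCont k x" "((\<lambda>y. snd (chart_at A (k x)) (k y)) has_derivative k') (at x)"
    and "d \<in> A'" "f (k x) \<in> fst d"
  shows "((\<lambda>y. snd d (f (k y))) has_derivative (\<lambda>v. to_coord A' d (f (k x)) (df (k x) (k' v)))) (at x)"
proof -
  let ?c = "chart_at A (k x)" and ?d = "chart_at A' (f (k x))"
  have near: "\<forall>\<^sub>F y in nhds x. k y \<in> U" if "open U" "k x \<in> U" for U
    using topological_tendstoD[of k "k x" "nhds x" U] assms(1) that
    by (simp add: isCont_def tendsto_at_iff_tendsto_nhds)
  have "((\<lambda>y. snd ?d (f (chart_inv ?c (snd ?c (k y))))) has_derivative (\<lambda>v. df (k x) (k' v))) (at x)"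
    using has_derivative_compose[OF assms(2), of "\<lambda>y. snd ?d (f (chart_inv ?c y))"] f_has_derivative[of "k x"]
    by simp
  then have "((\<lambda>y. snd ?d (f (k y))) has_derivative (\<lambda>v. df (k x) (k' v))) (at x)"
    by (rule has_derivative_transform_eventually)
      (use near[of "fst ?c"] in \<open>auto simp: eventually_at_filter elim!: eventually_mono\<close>)
  moreover have "\<forall>\<^sub>F y in nhds x. f (k y) \<in> fst ?d"
    using near[of "f -` fst ?d"] open_vimage_chart[of ?d] by simp
  ultimately show ?thesis
    using change_chart[of ?d d "\<lambda>y. f (k y)" x] assms by (simp add: to_coord_eq)
qed

lemma along_chain:
  fixes k :: "'x::real_normed_vector \<Rightarrow> 'q"
  assumes "isCont k x" "((\<lambda>y. snd (chart_at A (k x)) (k y)) has_derivative k') (at x)" "along V"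
  shows "((\<lambda>y. to_coord A' (chart_at A' (f (k x))) (f (k y)) (V (k y))) has_derivative
    (\<lambda>v. dir_deriv A (k x) (k' v) (\<lambda>q. to_coord A' (chart_at A' (f (k x))) (f q) (V q)))) (at x)"
proof -
  let ?c = "chart_at A (k x)" and ?d = "chart_at A' (f (k x))"
  let ?V = "(\<lambda>q. to_coord A' ?d (f q) (V q)) \<circ> chart_inv ?c"
  have near: "\<forall>\<^sub>F y in nhds x. k y \<in> U" if "open U" "k x \<in> U" for U
    using topological_tendstoD[of k "k x" "nhds x" U] assms(1) that
    by (simp add: isCont_def tendsto_at_iff_tendsto_nhds)
  have "smooth_on (snd ?c ` (fst ?c \<inter> f -` fst ?d)) ?V"
    using assms(3) unfolding smooth_vf_along_def by simp
  then have "(?V has_derivative (\<lambda>v. dir_deriv A (k x) v (\<lambda>q. to_coord A' ?d (f q) (V q)))) (at (snd ?c (k x)))"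
    unfolding dir_deriv_def by (rule smooth_on_has_derivative) simp
  from has_derivative_compose[OF assms(2) this]
  show ?thesis
    by (rule has_derivative_transform_eventually)
      (use near[of "fst ?c"] in \<open>auto simp: eventually_at_filter elim!: eventually_mono\<close>)
qed

lemma cov_eq:
  "cov V p v = dir_deriv A p v (\<lambda>q. to_coord A' (chart_at A' (f p)) (f q) (V q)) + christoffel (f p) (df p v) (V p)"
  unfolding cov_along_def christoffel_def Let_def by simp

lemma metric_chain:
  fixes k :: "'x::real_normed_vector \<Rightarrow> 'q"
  assumes k: "isCont k x" "((\<lambda>y. snd (chart_at A (k x)) (k y)) has_derivative k') (at x)"
    and "along V" "along W"
  shows "((\<lambda>y. g (f (k y)) (V (k y)) (W (k y))) has_derivative
    (\<lambda>u. g (f (k x)) (cov V (k x) (k' u)) (W (k x)) + g (f (k x)) (V (k x)) (cov W (k x) (k' u)))) (at x)"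
proof -
  let ?d = "chart_at A' (f (k x))"
  have near: "\<forall>\<^sub>F y in nhds x. f (k y) \<in> fst ?d"
    using topological_tendstoD[of k "k x" "nhds x" "f -` fst ?d"] k(1) open_vimage_chart[of ?d]
    by (simp add: isCont_def tendsto_at_iff_tendsto_nhds)
  have F: "((\<lambda>y. snd ?d (f (k y))) has_derivative (\<lambda>v. df (k x) (k' v))) (at x)"
    using f_chain[OF k, of ?d] by simp
  show ?thesis
    using metric_along_has_derivative[of "\<lambda>y. f (k y)" x, OF near F along_chain[OF k assms(3)]
        along_chain[OF k assms(4)]]
    by (simp add: cov_eq)
qed

lemma chart_inv_chain:
  assumes "c \<in> A" "p \<in> fst c"
  shows "isCont (chart_inv c) (snd c p)"
    "((\<lambda>y. snd (chart_at A (chart_inv c (snd c p))) (chart_inv c y)) has_derivative of_coord A c p) (at (snd c p))"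
proof -
  have "of_coord A c p = M.transD c (chart_at A p) p" by (simp add: M.of_coord_eq fun_eq_iff)
  then show "isCont (chart_inv c) (snd c p)"
    "((\<lambda>y. snd (chart_at A (chart_inv c (snd c p))) (chart_inv c y)) has_derivative of_coord A c p) (at (snd c p))"
    using M.isCont_chart_inv M.transition_has_derivative[of c "chart_at A p" p] assms by (simp_all add: o_def)
qed

lemma metric_chart:
  assumes "along V" "along W" "c \<in> A" "p \<in> fst c"
  shows "((\<lambda>y. g (f (chart_inv c y)) (V (chart_inv c y)) (W (chart_inv c y))) has_derivative
    (\<lambda>u. g (f p) (cov V p (of_coord A c p u)) (W p) + g (f p) (V p) (cov W p (of_coord A c p u)))) (at (snd c p))"
  using metric_chain[OF chart_inv_chain[OF assms(3,4)] assms(1,2)] assms by simp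

text \<open>A constant product has zero derivative. Applied to the relations of a null frame, this
  relates the derivatives of \<xi> and N.\<close>

lemma metric_const:
  assumes "along V" "along W" "\<And>q. g (f q) (V q) (W q) = r"
  shows "g (f p) (cov V p v) (W p) + g (f p) (V p) (cov W p v) = 0"
proof -
  have "((\<lambda>y. r) has_derivative (\<lambda>u. g (f p) (cov V p u) (W p) + g (f p) (V p) (cov W p u)))
      (at (snd (chart_at A p) p))"
    using metric_chart[OF assms(1,2), of "chart_at A p" p] by (simp add: assms(3))
  from has_derivative_unique[OF this has_derivative_const] show ?thesis by metis
qed

section \<open>Tangent fields and ambient fields regarded as fields along the immersion\<close>

lemma along_pushforward:
  assumes "smooth_vf_on A UNIV X"
  shows "along (\<lambda>q. df q (X q))"
  unfolding smooth_vf_along_def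
proof (intro ballI)
  fix c d assume cd: "c \<in> A" "d \<in> A'"
  let ?U = "snd c ` (fst c \<inter> f -` fst d)"
  let ?f = "\<lambda>y. snd d (f (chart_inv c y))"
  let ?X = "(\<lambda>q. to_coord A c q (X q)) \<circ> chart_inv c"
  have U: "open ?U" using open_f_chart cd by blast
  have "smooth_on ?U ?X"
    using assms cd unfolding smooth_vf_on_def by (auto elim!: smooth_on_mono)
  then have 1: "smooth_on ?U (\<lambda>y. frechet_derivative ?f (at y) (?X y))"
    by (rule smooth_on_derivative_field[OF U smooth_f[OF cd]])
  \<comment> \<open>The components of the pushed-forward field are the Jacobian of the coordinate
    form of \<open>f\<close> applied to the components of \<open>X\<close>.\<close>
  have 2: "frechet_derivative ?f (at y) (?X y) = to_coord A' d (f (chart_inv c y)) (df (chart_inv c y) (X (chart_inv c y)))"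
    if "y \<in> ?U" for y
  proof -
    obtain q where q: "q \<in> fst c" "f q \<in> fst d" "y = snd c q" using \<open>y \<in> ?U\<close> by auto
    then show ?thesis
      using frechet_derivative_at[OF f_chain[OF chart_inv_chain[OF cd(1) q(1)] cd(2)], symmetric] cd by simp
  qed
  show "smooth_on ?U ((\<lambda>q. to_coord A' d (f q) (df q (X q))) \<circ> chart_inv c)"
    using smooth_on_cong[OF U 2 1] by (simp add: o_def)
qed

lemma smooth_restrict_function:
  assumes "d \<in> A'" "c \<in> A" "smooth_on (snd d ` fst d) k"
  shows "smooth_on (snd c ` (fst c \<inter> f -` fst d)) (\<lambda>y. k (snd d (f (chart_inv c y))))"
  by (rule smooth_on_compose[OF open_f_chart[OF assms(2,1)] open_chart_image[OF assms(1) open_UNIV] _ _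
        smooth_f[OF assms(2,1)]]) (use assms in auto)

lemma along_restrict:
  assumes "smooth_vf_on A' UNIV Z"
  shows "along (Z \<circ> f)"
  unfolding smooth_vf_along_def
proof (intro ballI)
  fix c d assume cd: "c \<in> A" "d \<in> A'"
  have "smooth_on (snd d ` fst d) ((\<lambda>r. to_coord A' d r (Z r)) \<circ> chart_inv d)"
    using assms cd unfolding smooth_vf_on_def by auto
  from smooth_restrict_function[OF cd(2,1) this]
  show "smooth_on (snd c ` (fst c \<inter> f -` fst d)) ((\<lambda>p. to_coord A' d (f p) ((Z \<circ> f) p)) \<circ> chart_inv c)"
    by (rule smooth_on_cong[OF open_f_chart[OF cd], rotated]) (use cd in auto)
qed

text \<open>The coefficients of \<open>Z\<close> along \<open>f\<close> are those of
  \<open>Z\<close> composed with \<open>f\<close>, so the chain rule turns the direction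
  \<open>v\<close> into \<open>df p v\<close>, and the Christoffel terms agree. This is how the
  conformal equation reaches the hypersurface.\<close>

lemma cov_restrict:
  assumes "smooth_vf_on A' UNIV Z"
  shows "cov (Z \<circ> f) p v = nab (f p) (df p v) Z"
proof -
  let ?c = "chart_at A p" and ?d = "chart_at A' (f p)"
  let ?Z = "\<lambda>y. to_coord A' ?d (chart_inv ?d y) (Z (chart_inv ?d y))"
  have "smooth_on (snd ?d ` fst ?d) ?Z"
    using assms chart_at_mem[of "f p"] unfolding smooth_vf_on_def o_def by fastforce
  then have D: "(?Z has_derivative frechet_derivative ?Z (at (snd ?d (f p)))) (at (snd ?d (f p)))"
    by (rule smooth_on_has_derivative) simp
  have "((\<lambda>y. ?Z (snd ?d (f (chart_inv ?c y)))) has_derivative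
      (\<lambda>v. frechet_derivative ?Z (at (snd ?d (f p))) (df p v))) (at (snd ?c p))"
    using has_derivative_compose[OF f_has_derivative[of p], of ?Z] D by simp
  then have "((\<lambda>q. to_coord A' ?d (f q) ((Z \<circ> f) q)) \<circ> chart_inv ?c has_derivative
      (\<lambda>v. frechet_derivative ?Z (at (snd ?d (f p))) (df p v))) (at (snd ?c p))"
    by (rule has_derivative_transform_within_open[OF _ open_f_chart[of ?c ?d]]) auto
  from M.dir_deriv_eq[OF this] show ?thesis
    by (simp add: cov_eq nab_coordinates[OF assms D])
qed

text \<open>Differentiate \<open>g(V, \<partial>\<^sub>v(f \<circ> h)) = 0\<close> along an integral manifold \<open>h\<close> in the direction \<open>u\<close>: the
  term containing \<open>\<nabla>\<^sub>u \<partial>\<^sub>v(f \<circ> h)\<close> is symmetric in \<open>u\<close> and \<open>v\<close>.\<close>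

lemma integrable_symmetric:
  assumes "integrable_distribution A n S" "along V"
    and orth: "\<And>q x. x \<in> S q \<Longrightarrow> g (f q) (V q) (df q x) = 0"
    and xy: "x \<in> S p" "y \<in> S p"
  shows "g (f p) (cov V p x) (df p y) = g (f p) (cov V p y) (df p x)"
proof -
  obtain L W and h :: "'m \<Rightarrow> 'q" where L: "subspace L" and W: "open W" "0 \<in> W" "h 0 = p" "continuous_on W h"
    and smooth_h: "\<And>c. c \<in> A \<Longrightarrow> smooth_on (W \<inter> h -` fst c) (snd c \<circ> h)"
    and tangent: "\<And>w. w \<in> W \<Longrightarrow> w \<in> L \<Longrightarrow> frechet_derivative (snd (chart_at A (h w)) \<circ> h) (at w) ` L = S (h w)"
    using assms(1)[unfolded integrable_distribution_def, rule_format, of p] by blast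
  define h' where "h' = (\<lambda>w. frechet_derivative (snd (chart_at A (h w)) \<circ> h) (at w))"
  have open_vimage_h: "open (W \<inter> h -` U)" if "open U" for U
    using continuous_open_preimage[OF W(4,1) that] .
  have isCont_h: "isCont h w" if "w \<in> W" for w
    using W(1,4) that continuous_on_eq_continuous_at by blast
  have h': "((\<lambda>y. snd (chart_at A (h w)) (h y)) has_derivative h' w) (at w)" if "w \<in> W" for w
    using smooth_on_has_derivative[OF smooth_h[of "chart_at A (h w)"], of w] that
    by (simp add: h'_def o_def)
  let ?c = "chart_at A p" and ?d = "chart_at A' (f p)"
  \<comment> \<open>On this open set f o h stays in the chart preferred at \<open>f p\<close>, so a
    single coordinate form \<Phi> serves for all w near 0, although the preferred charts at
    \<open>h w\<close> vary.\<close>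
  define W0 where "W0 = W \<inter> h -` (fst ?c \<inter> f -` fst ?d)"
  have W0: "open W0" "0 \<in> W0"
    unfolding W0_def
    using open_vimage_h[OF open_Int[OF M.open_chart[of ?c] open_vimage_chart[of ?d]]] W by simp_all
  define \<Phi> where "\<Phi> = (\<lambda>w. snd ?d (f (h w)))"
  have smooth_\<Phi>: "smooth_on W0 \<Phi>"
  proof -
    have "smooth_on W0 (\<lambda>w. (\<lambda>y. snd ?d (f (chart_inv ?c y))) ((snd ?c \<circ> h) w))"
      by (rule smooth_on_compose[OF W0(1) open_f_chart[of ?c ?d] _ smooth_f
            smooth_on_mono[OF smooth_h[of ?c]]]) (auto simp: W0_def)
    then show ?thesis
      by (rule smooth_on_cong[OF W0(1), rotated]) (auto simp: \<Phi>_def W0_def)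
  qed
  \<comment> \<open>The field df(h' w v) along \<open>h\<close> has a directional derivative of
    \<Phi> as its component vector, so differentiating it produces a second derivative of
    \<Phi>.\<close>
  have D\<Phi>: "frechet_derivative \<Phi> (at w) v = to_coord A' ?d (f (h w)) (df (h w) (h' w v))" if "w \<in> W0" for w v
    using frechet_derivative_at[OF f_chain[OF isCont_h h', of w ?d], symmetric] that
    unfolding \<Phi>_def W0_def by simp
  have eq: "g (f p) (cov V p (h' 0 u)) (df p (h' 0 v)) +
      g (f p) (V p) (frechet_derivative (\<lambda>w. frechet_derivative \<Phi> (at w) v) (at 0) u +
        christoffel (f p) (df p (h' 0 u)) (df p (h' 0 v))) = 0"
    if uv: "u \<in> L" "v \<in> L" for u v
  proof -
    let ?Y = "\<lambda>w. df (h w) (h' w v)"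
    have near: "\<forall>\<^sub>F w in nhds 0. f (h w) \<in> fst ?d"
      using eventually_nhds_in_open[OF W0] by (rule eventually_mono) (simp add: W0_def)
    have F: "((\<lambda>w. snd ?d (f (h w))) has_derivative (\<lambda>v. df p (h' 0 v))) (at 0)"
      using f_chain[OF isCont_h h', of 0 ?d] W by simp
    have V: "((\<lambda>w. to_coord A' ?d (f (h w)) (V (h w))) has_derivative
        (\<lambda>v. dir_deriv A p (h' 0 v) (\<lambda>q. to_coord A' ?d (f q) (V q)))) (at 0)"
      using along_chain[OF isCont_h h' assms(2), of 0] W by simp
    have Y: "((\<lambda>w. to_coord A' ?d (f (h w)) (?Y w)) has_derivative
        (\<lambda>u. frechet_derivative (\<lambda>w. frechet_derivative \<Phi> (at w) v) (at 0) u)) (at 0)"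
      by (rule has_derivative_transform_within_open[OF
            smooth_on_has_derivative[OF smooth_on_derivative[OF smooth_\<Phi>] W0(2)] W0])
        (simp add: D\<Phi>)
    have D: "((\<lambda>w. g (f (h w)) (V (h w)) (?Y w)) has_derivative
      (\<lambda>u. g (f p) (cov V p (h' 0 u)) (df p (h' 0 v)) +
      g (f p) (V p) (frechet_derivative (\<lambda>w. frechet_derivative \<Phi> (at w) v) (at 0) u +
        christoffel (f p) (df p (h' 0 u)) (df p (h' 0 v))))) (at 0)"
      using metric_along_has_derivative[of "\<lambda>w. f (h w)" 0, unfolded W(3), OF near F V Y]
      by (simp add: cov_eq W(3))
    \<comment> \<open>Tangency to \<open>S\<close> is known only at points of \<open>W\<close> in
      \<open>L\<close>; the line spanned by \<open>u\<close> stays in \<open>L\<close>.\<close>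
    show ?thesis
    proof (rule derivative_zero_on_line[OF D W(1,2)])
      fix t :: real assume "t *\<^sub>R u \<in> W"
      then show "g (f (h (t *\<^sub>R u))) (V (h (t *\<^sub>R u))) (?Y (t *\<^sub>R u)) = 0"
        using tangent[of "t *\<^sub>R u"] subspace_scale[OF L uv(1)] uv(2) by (intro orth) (auto simp: h'_def)
    qed
  qed
  have "S p = h' 0 ` L"
    using tangent[OF W(2) subspace_0[OF L]] by (simp add: h'_def W(3))
  then obtain u v where uv: "u \<in> L" "v \<in> L" "x = h' 0 u" "y = h' 0 v"
    using xy by auto
  \<comment> \<open>The instances for (u, v) and (v, u) share their second summand, because the
    mixed derivatives of \<Phi> and the Christoffel term are symmetric. Subtraction leaves the
    claim.\<close>
  show ?thesis
    using eq[OF uv(1,2)] eq[OF uv(2,1)] second_derivative_symmetric[OF W0(1) smooth_\<Phi> W0(2), of u v]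
      christoffel_sym[of "f p" "df p x" "df p y"]
    unfolding uv(3,4) by simp
qed

end

section \<open>Null hypersurfaces\<close>

locale null_hypersurface_manifold = immersed_manifold A A' g nab f
  for A :: "('q::topological_space, 'm::euclidean_space) chart set"
    and A' :: "('p::topological_space, 'e::euclidean_space) chart set"
    and g :: "'p \<Rightarrow> 'e \<Rightarrow> 'e \<Rightarrow> real" and nab :: "'p \<Rightarrow> 'e \<Rightarrow> ('p \<Rightarrow> 'e) \<Rightarrow> 'e"
    and f :: "'q \<Rightarrow> 'p" +
  fixes n :: nat and S :: "'q \<Rightarrow> 'm set"
  assumes null: "null_hypersurface A A' g f n S"
begin

abbreviation "frame \<equiv> null_frame A A' g f S"

section \<open>Screen and radical at a point\<close>

lemma dims: "DIM('e) = n + 2" "DIM('m) = n + 1"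
  using null unfolding null_hypersurface_def by auto

lemma subspace_S: "subspace (S p)" and dim_S: "dim (S p) = n"
proof -
  obtain U E where "p \<in> U" "\<forall>q\<in>U. S q = span ((\<lambda>i. E i q) ` {..<n}) \<and> dim (S q) = n"
    using null unfolding null_hypersurface_def smooth_distribution_def by meson
  then have "S p = span ((\<lambda>i. E i p) ` {..<n}) \<and> dim (S p) = n" by blast
  then show "subspace (S p)" "dim (S p) = n" by (metis subspace_span, blast)
qed

lemma S_radical: "S p \<inter> radical A A' g f p = {0}"
  and S_radical_sum: "\<exists>a\<in>S p. \<exists>b\<in>radical A A' g f p. v = a + b"
  using null unfolding null_hypersurface_def by auto

lemma subspace_radical: "subspace (radical A A' g f p)"
  unfolding subspace_def radical_def
  by (auto simp: linear_0[OF linear_df] linear_add[OF linear_df] linear_cmul[OF linear_df])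

text \<open>The screen is an n-dimensional complement of the radical in a space of dimension n + 1,
  so the radical is a line.\<close>

lemma radical_span:
  assumes "x \<in> radical A A' g f p" "x \<noteq> 0"
  shows "radical A A' g f p = span {x}"
proof -
  let ?R = "radical A A' g f p"
  have "{a + b |a b. a \<in> S p \<and> b \<in> ?R} = UNIV"
    using S_radical_sum[of p] by blast
  then have "n + 1 = dim (S p) + dim ?R"
    using dim_sums_Int[OF subspace_S[of p] subspace_radical[of p]] S_radical[of p] dims by simp
  then have "dim ?R = 1" using dim_S[of p] by simp
  then have "span {x} = span ?R"
    using assms by (intro dim_eq_span) auto
  then show ?thesis using subspace_radical[of p] span_eq_iff by blast
qed

text \<open>A screen vector orthogonal to the screen is also orthogonal to the radical, hence to all
  of TM. It thus lies in the radical, which meets the screen only in 0.\<close>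

lemma S_nondegenerate:
  assumes "x \<in> S p" "\<And>y. y \<in> S p \<Longrightarrow> g (f p) (df p x) (df p y) = 0"
  shows "x = 0"
proof -
  have "g (f p) (df p x) (df p v) = 0" for v
  proof -
    obtain a b where v: "v = a + b" "a \<in> S p" "b \<in> radical A A' g f p"
      using S_radical_sum[of p v] by blast
    then have "g (f p) (df p x) (df p b) = 0"
      using g_sym[of "f p" "df p x" "df p b"] unfolding radical_def by simp
    then show ?thesis using v assms(2) by (simp add: linear_add[OF linear_df])
  qed
  then have "x \<in> radical A A' g f p" unfolding radical_def by simp
  then show ?thesis using S_radical[of p] assms(1) by blast
qed

section \<open>Gauss and Weingarten decompositions for a fixed null frame\<close>

context
  fixes \<xi> N assumes fr: "frame \<xi> N"
begin

lemma smooth_\<xi>: "smooth_vf_on A UNIV \<xi>" and along_N: "along N"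
  using fr unfolding null_frame_def by auto

lemma along_\<xi>: "along (\<lambda>q. df q (\<xi> q))"
  by (rule along_pushforward[OF smooth_\<xi>])

lemma \<xi>_radical: "\<xi> p \<in> radical A A' g f p" "\<xi> p \<noteq> 0"
  using fr unfolding null_frame_def Let_def by auto

lemma frame_simps [simp]:
  "g (f p) (df p (\<xi> p)) (df p v) = 0" "g (f p) (df p v) (df p (\<xi> p)) = 0"
  "g (f p) (df p (\<xi> p)) (N p) = 1" "g (f p) (N p) (df p (\<xi> p)) = 1" "g (f p) (N p) (N p) = 0"
  "x \<in> S p \<Longrightarrow> g (f p) (N p) (df p x) = 0" "x \<in> S p \<Longrightarrow> g (f p) (df p x) (N p) = 0"
  using fr unfolding null_frame_def Let_def radical_def
  by (auto simp: g_sym[of "f p" "df p v" "df p (\<xi> p)"] g_sym[of "f p" "N p" "df p (\<xi> p)"]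
      g_sym[of "f p" "df p x" "N p"])

lemma tangent_decomposition: "\<exists>s\<in>S p. \<exists>a. v = s + a *\<^sub>R \<xi> p"
proof -
  obtain s r where "v = s + r" "s \<in> S p" "r \<in> radical A A' g f p"
    using S_radical_sum[of p v] by blast
  then show ?thesis
    using radical_span[OF \<xi>_radical] by (auto simp: span_singleton)
qed

text \<open>The map \<open>L\<close> is injective, because pairing with \<xi> reads off the
  coefficient of N and \<open>df p\<close> is injective; both spaces have dimension n + 2, so it is
  onto. The coefficients of \<xi> and N follow by pairing with N and \<xi>.\<close>

lemma frame_decomposition:
  "\<exists>s\<in>S p. u = df p s + g (f p) u (N p) *\<^sub>R df p (\<xi> p) + g (f p) u (df p (\<xi> p)) *\<^sub>R N p"
proof -
  define L where "L = (\<lambda>(v, b). df p v + b *\<^sub>R N p)"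
  have L: "linear L"
    by (rule linearI)
      (auto simp: L_def linear_add[OF linear_df] linear_cmul[OF linear_df] algebra_simps)
  have "inj L"
  proof (rule linear_injective_0[OF L, THEN iffD2], intro allI impI)
    fix w assume w: "L w = 0"
    obtain v b where vb: "w = (v, b)" by (cases w)
    have 0: "df p v + b *\<^sub>R N p = 0" using w by (simp add: L_def vb)
    then have "g (f p) (df p v + b *\<^sub>R N p) (df p (\<xi> p)) = 0" by simp
    then have "b = 0" by (simp del: g_sum)
    then show "w = 0"
      using 0 inj_df[of p] linear_df[of p] vb by (simp add: linear_injective_0 zero_prod_def)
  qed
  then have "dim (range L) = DIM('m \<times> real)"
    using dim_image_eq[OF L, of UNIV] by (simp add: inj_on_def)
  then have "dim (range L) = DIM('e)" using dims by simp
  then have "range L = UNIV"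
    using dim_eq_full[of "range L"] linear_subspace_image[OF L subspace_UNIV] span_eq_iff by blast
  then obtain v b where u: "u = df p v + b *\<^sub>R N p"
    unfolding L_def by (metis (no_types, lifting) UNIV_I case_prod_conv imageE surj_pair)
  obtain s a where v: "s \<in> S p" "v = s + a *\<^sub>R \<xi> p"
    using tangent_decomposition[of p v] by blast
  have "u = df p s + a *\<^sub>R df p (\<xi> p) + b *\<^sub>R N p"
    using u v by (simp add: linear_add[OF linear_df] linear_cmul[OF linear_df])
  moreover from this have "g (f p) u (N p) = a" "g (f p) u (df p (\<xi> p)) = b"
    using v by simp_all
  ultimately show ?thesis using v(1) by metis
qed

lemma df_N_eqD:
  assumes "df p v + b *\<^sub>R N p = df p v' + b' *\<^sub>R N p"
  shows "v = v'" "b = b'"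
proof -
  have "g (f p) (df p v + b *\<^sub>R N p) (df p (\<xi> p)) = g (f p) (df p v' + b' *\<^sub>R N p) (df p (\<xi> p))"
    using assms by simp
  then show "b = b'" by simp
  then show "v = v'" using assms inj_df[of p] by (simp add: inj_eq)
qed

text \<open>These come from differentiating g(\<xi>,\<xi>) = 0, g(N,N) = 0 and g(\<xi>,N) = 1. The
  third one lets a single one-form \<tau> serve both Weingarten equations.\<close>

lemma cov_frame [simp]:
  "g (f p) (cov (\<lambda>q. df q (\<xi> q)) p v) (df p (\<xi> p)) = 0"
  "g (f p) (cov N p v) (N p) = 0"
  "g (f p) (cov (\<lambda>q. df q (\<xi> q)) p v) (N p) = - g (f p) (cov N p v) (df p (\<xi> p))"
  using metric_const[OF along_\<xi> along_\<xi>, of 0 p v] metric_const[OF along_N along_N, of 0 p v]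
    metric_const[OF along_\<xi> along_N, of 1 p v] g_sym[of "f p"]
  by simp_all

text \<open>The derivative of N has no \<xi>-coefficient, since N remains null. Existence thus
  follows from \<open>frame_decomposition\<close> and uniqueness from \<open>df_N_eqD\<close>, so
  both definite descriptions denote.\<close>

lemma shape_N:
  "shape_N A A' nab f S N p v \<in> S p \<and>
    cov N p v = - df p (shape_N A A' nab f S N p v) + g (f p) (cov N p v) (df p (\<xi> p)) *\<^sub>R N p"
  and rotation_form: "rotation_form A A' nab f S N p v = g (f p) (cov N p v) (df p (\<xi> p))"
proof -
  let ?t = "g (f p) (cov N p v) (df p (\<xi> p))"
  obtain s where s: "s \<in> S p" "cov N p v = df p s + ?t *\<^sub>R N p"
    using frame_decomposition[of p "cov N p v"] by auto
  have neg: "- df p a = df p (- a)" for a by (simp add: linear_neg[OF linear_df])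
  have *: "a = - s \<and> t = ?t" if "cov N p v = - df p a + t *\<^sub>R N p" for a t
    using df_N_eqD[of p s ?t "- a" t] s(2) that by (simp add: neg)
  have ex: "- s \<in> S p" "cov N p v = - df p (- s) + ?t *\<^sub>R N p"
    using s subspace_neg[OF subspace_S] by (simp_all add: neg)
  have "shape_N A A' nab f S N p v = - s"
    unfolding shape_N_def by (rule the_equality) (use ex * in blast)+
  then show "shape_N A A' nab f S N p v \<in> S p \<and>
    cov N p v = - df p (shape_N A A' nab f S N p v) + ?t *\<^sub>R N p" using ex by simp
  show "rotation_form A A' nab f S N p v = ?t"
    unfolding rotation_form_def by (rule the_equality) (use ex * in blast)+
qed

text \<open>The derivative of \<xi> has no N-coefficient, since \<xi> remains null; it is therefore
  tangent to M and equals the induced derivative. Its \<xi>-coefficient is -\<tau> because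
  g(\<xi>,N) is constant.\<close>

lemma shape_xi:
  "shape_xi A A' nab f S \<xi> N p v \<in> S p \<and>
    cov (\<lambda>q. df q (\<xi> q)) p v =
      - df p (shape_xi A A' nab f S \<xi> N p v) - g (f p) (cov N p v) (df p (\<xi> p)) *\<^sub>R df p (\<xi> p)"
proof -
  let ?t = "g (f p) (cov N p v) (df p (\<xi> p))"
  obtain s where s: "s \<in> S p" "cov (\<lambda>q. df q (\<xi> q)) p v = df p s - ?t *\<^sub>R df p (\<xi> p)"
    using frame_decomposition[of p "cov (\<lambda>q. df q (\<xi> q)) p v"] by auto
  then have c: "cov (\<lambda>q. df q (\<xi> q)) p v = df p (s - ?t *\<^sub>R \<xi> p) + 0 *\<^sub>R N p"
    by (simp add: linear_diff[OF linear_df] linear_cmul[OF linear_df])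
  have "induced_conn A A' nab f N \<xi> p v = s - ?t *\<^sub>R \<xi> p"
    unfolding induced_conn_def
    by (rule the_equality) (use c df_N_eqD in \<open>metis+\<close>)
  then have "shape_xi A A' nab f S \<xi> N p v = - s"
    unfolding shape_xi_def rotation_form
    using s(1) subspace_neg[OF subspace_S] by (intro the_equality) auto
  then show ?thesis
    using s subspace_neg[OF subspace_S] by (simp add: linear_neg[OF linear_df])
qed

lemma screen_part:
  "screen_part A A' g f S \<xi> N V p \<in> S p \<and>
    V p = df p (screen_part A A' g f S \<xi> N V p) + g (f p) (V p) (N p) *\<^sub>R df p (\<xi> p)
      + g (f p) (V p) (df p (\<xi> p)) *\<^sub>R N p"
  unfolding screen_part_def Let_def
proof (rule theI')
  show "\<exists>!a. a \<in> S p \<and> V p = df p a + g (f p) (V p) (N p) *\<^sub>R df p (\<xi> p)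
      + g (f p) (V p) (df p (\<xi> p)) *\<^sub>R N p"
    using frame_decomposition[of p "V p"] inj_df[of p, THEN injD]
    by (metis add_right_cancel)
qed

lemma shape_perp_in_S: "shape_perp A A' g nab f S \<xi> N V p x \<in> S p"
  unfolding shape_perp_def
  using shape_N shape_xi by (intro subspace_add[OF subspace_S] subspace_scale[OF subspace_S]) auto

text \<open>Pairing with a screen vector annihilates the \<xi> and N parts of the Weingarten
  equations, leaving the shape operators with a minus sign.\<close>

lemma shape_perp_product:
  assumes "y \<in> S p"
  shows "g (f p) (df p (shape_perp A A' g nab f S \<xi> N V p x)) (df p y) =
    - (g (f p) (V p) (N p) * g (f p) (cov (\<lambda>q. df q (\<xi> q)) p x) (df p y) +
       g (f p) (V p) (df p (\<xi> p)) * g (f p) (cov N p x) (df p y))"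
proof -
  have "g (f p) (df p (shape_N A A' nab f S N p x)) (df p y) = - g (f p) (cov N p x) (df p y)"
    using arg_cong[OF conjunct2[OF shape_N[of p x]], of "\<lambda>u. g (f p) u (df p y)"] assms by simp
  moreover have "g (f p) (df p (shape_xi A A' nab f S \<xi> N p x)) (df p y) =
      - g (f p) (cov (\<lambda>q. df q (\<xi> q)) p x) (df p y)"
    using arg_cong[OF conjunct2[OF shape_xi[of p x]], of "\<lambda>u. g (f p) u (df p y)"] by simp
  ultimately show ?thesis
    by (simp add: shape_perp_def linear_add[OF linear_df] linear_cmul[OF linear_df])
qed

text \<open>Each angle carries a factor 1/|V|, so the product of the two carries 1/|g(V,V)|.\<close>

lemma angle_product:
  assumes "nowhere_null g f V"
  shows "g (f p) (V p) (N p) * g (f p) (V p) (df p (\<xi> p)) =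
    angle_xi A A' g f V \<xi> p * angle_N g f V N p * \<bar>g (f p) (V p) (V p)\<bar>"
proof -
  have "sqrt \<bar>g (f p) (V p) (V p)\<bar> * sqrt \<bar>g (f p) (V p) (V p)\<bar> = \<bar>g (f p) (V p) (V p)\<bar>" by simp
  moreover have "g (f p) (V p) (V p) \<noteq> 0" using assms unfolding nowhere_null_def by blast
  ultimately show ?thesis
    unfolding angle_xi_def angle_N_def by (simp add: mult.commute)
qed

end

section \<open>Change of frame and the eigenvalue equation\<close>

lemma frame_product:
  assumes fr: "frame \<xi> N" and fr0: "frame \<xi>0 N0"
  shows "g (f p) u (N p) * g (f p) u (df p (\<xi> p)) = g (f p) u (N0 p) * g (f p) u (df p (\<xi>0 p))"
proof -
  \<comment> \<open>The radical is a line, so the two sections differ by a factor r; the rest of the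
    proof shows N0 = N / r.\<close>
  have "\<xi>0 p \<in> span {\<xi> p}"
    using radical_span[OF \<xi>_radical[OF fr]] \<xi>_radical[OF fr0] by blast
  then obtain r where r: "\<xi>0 p = r *\<^sub>R \<xi> p" by (auto simp: span_singleton)
  have df0: "df p (\<xi>0 p) = r *\<^sub>R df p (\<xi> p)" by (simp add: r linear_cmul[OF linear_df])
  obtain s where s: "s \<in> S p" and
    N0: "N0 p = df p s + g (f p) (N0 p) (N p) *\<^sub>R df p (\<xi> p) + g (f p) (N0 p) (df p (\<xi> p)) *\<^sub>R N p"
    using frame_decomposition[OF fr, of p "N0 p"] by blast
  have rb: "r * g (f p) (N0 p) (df p (\<xi> p)) = 1"
    using frame_simps(4)[OF fr0, of p] by (simp add: df0)
  \<comment> \<open>N0, N and \<xi> are orthogonal to the screen, hence so is the screen part s of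
    N0.\<close>
  have "g (f p) (df p s) (df p y) = 0" if "y \<in> S p" for y
    using arg_cong[OF N0, of "\<lambda>u. g (f p) u (df p y)"] that
    by (simp add: frame_simps[OF fr] frame_simps(6)[OF fr0])
  then have "s = 0" using S_nondegenerate[OF s] by blast
  then have N0': "N0 p = g (f p) (N0 p) (N p) *\<^sub>R df p (\<xi> p) + g (f p) (N0 p) (df p (\<xi> p)) *\<^sub>R N p"
    using N0 by (simp add: linear_0[OF linear_df])
  \<comment> \<open>This expands g(N0,N0) = 0. The coefficient of N is 1/r by \<open>rb\<close>,
    hence nonzero, so that of \<xi> must vanish.\<close>
  have "0 = 2 * (g (f p) (N0 p) (N p) * g (f p) (N0 p) (df p (\<xi> p)))"
    using arg_cong[OF N0', of "\<lambda>u. g (f p) (N0 p) u"] by (simp add: frame_simps[OF fr0])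
  then have "g (f p) (N0 p) (N p) = 0" using rb by auto
  then have "N0 p = g (f p) (N0 p) (df p (\<xi> p)) *\<^sub>R N p" using N0' by simp
  then have "g (f p) u (N0 p) = g (f p) (N0 p) (df p (\<xi> p)) * g (f p) u (N p)" by (metis g_simps(6))
  then show ?thesis using rb by (simp add: df0 mult.commute[of r])
qed

text \<open>Constant angle enters only as the equation for \<open>C\<close>, which passes from one
  null frame to all others; so the given frame is used throughout.\<close>

lemma shape_perp_screen_part:
  assumes fr: "frame \<xi> N" and int: "integrable_distribution A n S"
    and Z: "closed_conformal A' nab Z \<phi>" and nn: "nowhere_null g f (Z \<circ> f)"
    and C: "\<And>q. g (f q) (Z (f q)) (N q) * g (f q) (Z (f q)) (df q (\<xi> q)) =
      C * \<bar>g (f q) (Z (f q)) (Z (f q))\<bar>"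
  shows "shape_perp A A' g nab f S \<xi> N (Z \<circ> f) p (screen_part A A' g f S \<xi> N (Z \<circ> f) p) =
    (- 2 * sgn (g (f p) (Z (f p)) (Z (f p))) * C * \<phi> (f p)) *\<^sub>R screen_part A A' g f S \<xi> N (Z \<circ> f) p"
proof -
  note [simp] = frame_simps[OF fr] cov_frame[OF fr]
  let ?z = "screen_part A A' g f S \<xi> N (Z \<circ> f) p"
  let ?Az = "shape_perp A A' g nab f S \<xi> N (Z \<circ> f) p ?z"
  let ?\<xi> = "\<lambda>q. df q (\<xi> q)"
  let ?p = "f p"
  define a where "a = g ?p (Z ?p) (N p)"
  define b where "b = g ?p (Z ?p) (?\<xi> p)"
  define s where "s = sgn (g ?p (Z ?p) (Z ?p))"
  have z: "?z \<in> S p" "Z ?p = df p ?z + a *\<^sub>R ?\<xi> p + b *\<^sub>R N p"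
    using screen_part[OF fr, of "Z \<circ> f" p] by (auto simp: a_def b_def)
  have smooth_Z: "smooth_vf_on A' UNIV Z" and nab_Z: "\<And>r v. nab r v Z = \<phi> r *\<^sub>R v"
    using Z unfolding closed_conformal_def by auto
  have along_Z: "along (Z \<circ> f)" by (rule along_restrict[OF smooth_Z])
  have cov_Z: "cov (Z \<circ> f) p v = \<phi> ?p *\<^sub>R df p v" for v
    by (simp add: cov_restrict[OF smooth_Z] nab_Z)
  let ?c = "chart_at A p"
  have dir: "((\<lambda>y. g (f (chart_inv ?c y)) (V (chart_inv ?c y)) (W (chart_inv ?c y))) has_derivative
    (\<lambda>u. g ?p (cov V p u) (W p) + g ?p (V p) (cov W p u))) (at (snd ?c p))" if "along V" "along W" for V W
    using metric_chart[OF that, of ?c p] by simp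
  \<comment> \<open>This is the derivative of ab = C |g(Z,Z)| in direction y, by \<open>D2\<close>
    on the left and \<open>D1\<close> on the right. The products of \<phi> df(y) with \<xi> and N
    drop out as y lies in the screen; the factor 2 comes from the quadratic g(Z,Z), the sign s from
    the absolute value.\<close>
  have product: "a * g ?p (cov ?\<xi> p y) (Z ?p) + b * g ?p (cov N p y) (Z ?p) =
      C * (2 * s * \<phi> ?p * g ?p (df p y) (df p ?z))" if y: "y \<in> S p" for y
  proof -
    define Q where "Q = (\<lambda>x. g (f (chart_inv ?c x)) (Z (f (chart_inv ?c x))) (Z (f (chart_inv ?c x))))"
    have Q0: "Q (snd ?c p) = g ?p (Z ?p) (Z ?p)" by (simp add: Q_def)
    have "g ?p (Z ?p) (Z ?p) \<noteq> 0" using nn by (simp add: nowhere_null_def)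
    then have abs: "(abs has_derivative (\<lambda>x. s * x)) (at (Q (snd ?c p)))"
      unfolding Q0 s_def by (rule has_derivative_abs_nonzero)
    have D1: "((\<lambda>x. C * \<bar>Q x\<bar>) has_derivative (\<lambda>u. C * (s * (2 * \<phi> ?p * g ?p (df p u) (Z ?p))))) (at (snd ?c p))"
    proof (rule has_derivative_mult_right)
      have "(Q has_derivative (\<lambda>u. 2 * \<phi> ?p * g ?p (df p u) (Z ?p))) (at (snd ?c p))"
        using dir[OF along_Z along_Z] g_sym[of ?p "Z ?p"] by (simp add: Q_def cov_Z mult.assoc)
      from has_derivative_compose[OF this abs]
      show "((\<lambda>x. \<bar>Q x\<bar>) has_derivative (\<lambda>u. s * (2 * \<phi> ?p * g ?p (df p u) (Z ?p)))) (at (snd ?c p))" .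
    qed
    have D2: "((\<lambda>x. C * \<bar>Q x\<bar>) has_derivative
      (\<lambda>u. a * (g ?p (\<phi> ?p *\<^sub>R df p u) (?\<xi> p) + g ?p (Z ?p) (cov ?\<xi> p u)) +
        (g ?p (\<phi> ?p *\<^sub>R df p u) (N p) + g ?p (Z ?p) (cov N p u)) * b)) (at (snd ?c p))"
      using has_derivative_mult[OF dir[OF along_Z along_N[OF fr]] dir[OF along_Z along_\<xi>[OF fr]]] C
      by (simp add: Q_def cov_Z a_def b_def)
    have "C * (s * (2 * \<phi> ?p * g ?p (df p y) (Z ?p))) =
        a * g ?p (Z ?p) (cov ?\<xi> p y) + g ?p (Z ?p) (cov N p y) * b"
      using fun_cong[OF has_derivative_unique[OF D1 D2], of y] y by simp
    moreover have "g ?p (df p y) (Z ?p) = g ?p (df p y) (df p ?z)"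
      using arg_cong[OF z(2), of "\<lambda>u. g ?p (df p y) u"] y by simp
    ultimately show ?thesis using g_sym[of ?p "Z ?p"] by (simp add: mult_ac)
  qed
  have "g ?p (df p ?Az) (df p y) = - (2 * s * C * \<phi> ?p) * g ?p (df p ?z) (df p y)" if y: "y \<in> S p" for y
  proof -
    \<comment> \<open>\<xi> and N are both orthogonal to the screen, so
      \<open>integrable_symmetric\<close> applies to each; the symmetry of the combined operator is
      used in this split form.\<close>
    have sym: "g ?p (cov ?\<xi> p ?z) (df p y) = g ?p (cov ?\<xi> p y) (df p ?z)"
      "g ?p (cov N p ?z) (df p y) = g ?p (cov N p y) (df p ?z)"
      using integrable_symmetric[OF int along_\<xi>[OF fr] _ z(1) y]
        integrable_symmetric[OF int along_N[OF fr] _ z(1) y] by simp_all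
    \<comment> \<open>Inserting Z = z + a \<xi> + b N leaves one cross term in each product.
      Weighted with a and b, they are -ab and +ab times the same number.\<close>
    have expand: "g ?p (cov ?\<xi> p y) (Z ?p) = g ?p (cov ?\<xi> p y) (df p ?z) - b * g ?p (cov N p y) (?\<xi> p)"
      "g ?p (cov N p y) (Z ?p) = g ?p (cov N p y) (df p ?z) + a * g ?p (cov N p y) (?\<xi> p)"
      using arg_cong[OF z(2), of "g ?p (cov ?\<xi> p y)"] arg_cong[OF z(2), of "g ?p (cov N p y)"] by simp_all
    have "a * g ?p (cov ?\<xi> p y) (df p ?z) + b * g ?p (cov N p y) (df p ?z) =
        C * (2 * s * \<phi> ?p * g ?p (df p y) (df p ?z))"
      using product[OF y] unfolding expand by (simp add: algebra_simps)
    then show ?thesis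
      using shape_perp_product[OF fr y, of "Z \<circ> f" ?z] g_sym[of ?p "df p y" "df p ?z"]
      by (simp add: sym a_def[symmetric] b_def[symmetric] mult_ac)
  qed
  \<comment> \<open>Both vectors lie in the screen and have the same products with all of
    it.\<close>
  then have "?Az - (- (2 * s * C * \<phi> ?p)) *\<^sub>R ?z = 0"
    using z(1) shape_perp_in_S[OF fr]
    by (intro S_nondegenerate[of _ p] subspace_diff[OF subspace_S] subspace_scale[OF subspace_S])
      (auto simp: linear_add[OF linear_df] linear_cmul[OF linear_df])
  then show ?thesis by (simp add: s_def eq_neg_iff_add_eq_0)
qed

text \<open>\<open>sgn\<close> itself is not continuous at 0, but g(Z,Z) is continuous without zeros
  along \<open>f\<close>, so its sign is locally constant.\<close>

lemma smooth_fun_principal_curvature: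
  assumes Z: "closed_conformal A' nab Z \<phi>" and nn: "nowhere_null g f (Z \<circ> f)"
  shows "smooth_fun_on A UNIV (\<lambda>q. r * sgn (g (f q) (Z (f q)) (Z (f q))) * C * \<phi> (f q))"
  unfolding smooth_fun_on_def
proof
  fix c assume c: "c \<in> A"
  let ?Q = "\<lambda>y. g (f (chart_inv c y)) (Z (f (chart_inv c y))) (Z (f (chart_inv c y)))"
  let ?l = "(\<lambda>q. r * sgn (g (f q) (Z (f q)) (Z (f q))) * C * \<phi> (f q)) \<circ> chart_inv c"
  have along_Z: "along (Z \<circ> f)" and smooth_\<phi>: "smooth_fun_on A' UNIV \<phi>"
    using Z along_restrict unfolding closed_conformal_def by auto
  have open_c: "open (snd c ` fst c)" using M.open_chart_image[OF c open_UNIV] by simp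
  have "continuous_on (snd c ` fst c) ?Q"
    using has_derivative_continuous[OF metric_chart[OF along_Z along_Z c]]
    by (auto intro!: continuous_at_imp_continuous_on)
  then have cont: "continuous_on (snd c ` fst c) (\<lambda>y. k * ?Q y)" for k by (intro continuous_intros)
  show "smooth_on (snd c ` (fst c \<inter> UNIV)) ?l"
  proof (rule smooth_on_local)
    fix y assume "y \<in> snd c ` (fst c \<inter> UNIV)"
    then obtain p where p: "p \<in> fst c" "y = snd c p" by auto
    let ?d = "chart_at A' (f p)"
    let ?s = "sgn (g (f p) (Z (f p)) (Z (f p)))"
    have s: "?s * g (f p) (Z (f p)) (Z (f p)) > 0"
      using nn by (simp add: nowhere_null_def abs_sgn[symmetric] mult.commute)
    \<comment> \<open>On this neighbourhood the sign can be frozen at its value at \<open>p\<close>,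
      and \<phi> can be read in a single ambient chart.\<close>
    let ?V = "snd c ` (fst c \<inter> f -` fst ?d) \<inter> (snd c ` fst c \<inter> (\<lambda>y. ?s * ?Q y) -` {0<..})"
    have V: "open ?V"
      by (rule open_Int[OF open_f_chart[OF c chart_at_mem]
            continuous_open_preimage[OF cont open_c open_greaterThan]])
    have "smooth_on (snd ?d ` fst ?d) (\<phi> \<circ> chart_inv ?d)"
      using smooth_\<phi> chart_at_mem[of "f p"] unfolding smooth_fun_on_def by fastforce
    then have "smooth_on (snd c ` (fst c \<inter> f -` fst ?d)) (\<lambda>y. (\<phi> \<circ> chart_inv ?d) (snd ?d (f (chart_inv c y))))"
      by (rule smooth_restrict_function[OF chart_at_mem c])
    then have 1: "smooth_on ?V (\<lambda>y. (r * ?s * C) *\<^sub>R (\<phi> \<circ> chart_inv ?d) (snd ?d (f (chart_inv c y))))"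
      by (intro smooth_on_scaleR[OF V smooth_on_const]) (rule smooth_on_mono, auto)
    have 2: "(r * ?s * C) *\<^sub>R (\<phi> \<circ> chart_inv ?d) (snd ?d (f (chart_inv c y))) = ?l y" if yV: "y \<in> ?V" for y
    proof -
      have "?s * ?Q y > 0" using yV by auto
      then have "sgn (?Q y) = ?s" by (auto simp: sgn_if zero_less_mult_iff split: if_splits)
      moreover obtain q where "q \<in> fst c" "f q \<in> fst ?d" "y = snd c q" using yV by blast
      ultimately show ?thesis using c by simp
    qed
    have "smooth_on ?V ?l" by (rule smooth_on_cong[OF V 2 1])
    moreover have "y \<in> ?V" using p s c by auto
    ultimately show "\<exists>V. open V \<and> y \<in> V \<and> smooth_on V ?l" using V by blast
  qed
qed

end

theorem theorem5p3:
  fixes A :: "('q::{t2_space, second_countable_topology}, 'm::euclidean_space) chart set"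
    and A' :: "('p::{t2_space, second_countable_topology}, 'e::euclidean_space) chart set"
    and g :: "'p \<Rightarrow> 'e \<Rightarrow> 'e \<Rightarrow> real"
    and nab :: "'p \<Rightarrow> 'e \<Rightarrow> ('p \<Rightarrow> 'e) \<Rightarrow> 'e"
    and f :: "'q \<Rightarrow> 'p"
    and n :: nat
    and S :: "'q \<Rightarrow> 'm set"
    and Z :: "'p \<Rightarrow> 'e"
    and \<phi> :: "'p \<Rightarrow> real"
  assumes "smooth_atlas A'"
    and "lorentzian_metric A' g"
    and "levi_civita A' g nab"
    and "smooth_atlas A"
    and "null_hypersurface A A' g f n S"
    and "integrable_distribution A n S"
    and "closed_conformal A' nab Z \<phi>"
    and "nowhere_null g f (Z \<circ> f)"
    and "constant_angle A A' g f S (Z \<circ> f)"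
  shows "\<forall>\<xi> N. null_frame A A' g f S \<xi> N \<longrightarrow>
      canonical_principal_direction A A' g nab f S \<xi> N (Z \<circ> f) \<and>
      (\<forall>p. shape_perp A A' g nab f S \<xi> N (Z \<circ> f) p (screen_part A A' g f S \<xi> N (Z \<circ> f) p) =
        (- 2 * sgn (g (f p) (Z (f p)) (Z (f p))) *
           angle_xi A A' g f (Z \<circ> f) \<xi> p * angle_N g f (Z \<circ> f) N p * \<phi> (f p)) *\<^sub>R
        screen_part A A' g f S \<xi> N (Z \<circ> f) p)"
proof (intro allI impI)
  fix \<xi> :: "'q \<Rightarrow> 'm" and N :: "'q \<Rightarrow> 'e"
  assume fr: "null_frame A A' g f S \<xi> N"
  interpret null_hypersurface_manifold A A' g nab f n S
    using assms
    by unfold_locales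
      (auto simp: lorentzian_metric_def lorentzian_form_def null_hypersurface_def)
  \<comment> \<open>The frame with constant angles need not be the given one; only the product c1 c2
    of its angles is transferred.\<close>
  obtain \<xi>0 N0 c1 c2 where fr0: "frame \<xi>0 N0"
    and c: "\<And>q. angle_xi A A' g f (Z \<circ> f) \<xi>0 q = c1" "\<And>q. angle_N g f (Z \<circ> f) N0 q = c2"
    using assms(9) unfolding constant_angle_def constant_on_def by blast
  have C: "g (f q) (Z (f q)) (N q) * g (f q) (Z (f q)) (df q (\<xi> q)) = c1 * c2 * \<bar>g (f q) (Z (f q)) (Z (f q))\<bar>" for q
    using angle_product[OF fr0 assms(8), of q] frame_product[OF fr fr0, of q "Z (f q)"] by (simp add: c)
  note main = shape_perp_screen_part[OF fr assms(6-8) C]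
  \<comment> \<open>Cancelling the nonzero factor |g(Z,Z)| expresses c1 c2 by the angles of the
    given frame, which need not be constant separately.\<close>
  have angles: "angle_xi A A' g f (Z \<circ> f) \<xi> p * angle_N g f (Z \<circ> f) N p = c1 * c2" for p
    using angle_product[OF fr assms(8), of p] C[of p] assms(8) by (simp add: nowhere_null_def)
  have "canonical_principal_direction A A' g nab f S \<xi> N (Z \<circ> f)"
    unfolding canonical_principal_direction_def Let_def
    using main smooth_fun_principal_curvature[OF assms(7,8), of "- 2" "c1 * c2"] by blast
  moreover have "shape_perp A A' g nab f S \<xi> N (Z \<circ> f) p (screen_part A A' g f S \<xi> N (Z \<circ> f) p) =
        (- 2 * sgn (g (f p) (Z (f p)) (Z (f p))) *
           angle_xi A A' g f (Z \<circ> f) \<xi> p * angle_N g f (Z \<circ> f) N p * \<phi> (f p)) *\<^sub>R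
        screen_part A A' g f S \<xi> N (Z \<circ> f) p" for p
    using main[of p] angles[of p] by (simp add: mult.assoc)
  ultimately show "canonical_principal_direction A A' g nab f S \<xi> N (Z \<circ> f) \<and>
      (\<forall>p. shape_perp A A' g nab f S \<xi> N (Z \<circ> f) p (screen_part A A' g f S \<xi> N (Z \<circ> f) p) =
        (- 2 * sgn (g (f p) (Z (f p)) (Z (f p))) *
           angle_xi A A' g f (Z \<circ> f) \<xi> p * angle_N g f (Z \<circ> f) N p * \<phi> (f p)) *\<^sub>R
        screen_part A A' g f S \<xi> N (Z \<circ> f) p)" by blast
qed

end
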